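(* Let $p$ be a prime and let $K$ be a Galois number field of degree $[K:\mathbb{Q}] = p^r$, with ideal class group $\mathrm{Cl}_K$ and class number $h_K = |\mathrm{Cl}_K|$. Let $q$ be a prime such that the Sylow $q$-subgroup $S(q)$ of $\mathrm{Cl}_K$ is non-trivial. Then $p = q$ or $|S(q)| \equiv 1 \pmod p$. Therefore, if $h_K = p^{s} q_1^{n_1} \cdots q_k^{n_k}$ with $s \geq 0$, with $q_1,\dots,q_k$ distinct primes different from $p$, and with $n_i \geq 1$, then $q_i^{n_i} \equiv 1 \pmod p$ for all $1 \leq i \leq k$.
   Context: A Galois number field is a number field that is Galois over $\mathbb{Q}$. *)

theory Defs
  imports
    "HOL-Algebra.Algebraic_Closure_Type"
    "HOL-Algebra.Coset"
    "HOL-Number_Theory.Cong"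
begin

text \<open>Number fields are subfields \<open>K\<close> of an arbitrary ambient field of characteristic zero
  (such as the complex numbers); the base field of rational numbers is the prime
  subfield \<open>\<rat>\<close> of the ambient field.\<close>

interpretation rat_vs: vector_space "\<lambda>(c::rat) (x::'a::field_char_0). of_rat c * x"
  by unfold_locales (simp_all add: algebra_simps of_rat_add of_rat_mult)

definition field_on :: "'a::field set \<Rightarrow> 'a ring" where
  "field_on K = ring_of_type_algebra\<lparr>carrier := K\<rparr>"

definition number_field :: "'a::field_char_0 set \<Rightarrow> bool" where
  "number_field K \<longleftrightarrow>
     subfield K ring_of_type_algebra \<and> (\<exists>B. finite B \<and> B \<subseteq> K \<and> rat_vs.span B = K)"

definition degree_over_Q :: "'a::field_char_0 set \<Rightarrow> nat" where
  "degree_over_Q K = rat_vs.dim K"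

text \<open>Members of \<^const>\<open>ring_iso\<close> are constrained only on the carrier, so an automorphism of \<open>K\<close>
  is represented by many functions on the ambient type; the set below must not be counted.\<close>

definition automorphisms_over_Q :: "'a::field_char_0 set \<Rightarrow> ('a \<Rightarrow> 'a) set" where
  "automorphisms_over_Q K = {\<sigma> \<in> ring_iso (field_on K) (field_on K). \<forall>x\<in>\<rat>. \<sigma> x = x}"

text \<open>A finite extension is Galois if the base field is the fixed field of its
  automorphism group.\<close>

definition galois_number_field :: "'a::field_char_0 set \<Rightarrow> bool" where
  "galois_number_field K \<longleftrightarrow>
     number_field K \<and> {x \<in> K. \<forall>\<sigma>\<in>automorphisms_over_Q K. \<sigma> x = x} = \<rat>"

definition ring_of_integers :: "'a::field_char_0 set \<Rightarrow> 'a set" where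
  "ring_of_integers K = {x \<in> K. algebraic_int x}"

definition fractional_ideal :: "'a::field_char_0 set \<Rightarrow> 'a set \<Rightarrow> bool" where
  "fractional_ideal K I \<longleftrightarrow>
     I \<subseteq> K \<and> 0 \<in> I \<and> (\<forall>x\<in>I. \<forall>y\<in>I. x + y \<in> I) \<and>
     (\<forall>a\<in>ring_of_integers K. \<forall>x\<in>I. a * x \<in> I) \<and>
     (\<exists>d\<in>ring_of_integers K. d \<noteq> 0 \<and> (\<forall>x\<in>I. d * x \<in> ring_of_integers K))"

definition fractional_ideal_mult :: "'a::field_char_0 set \<Rightarrow> 'a set \<Rightarrow> 'a set" where
  "fractional_ideal_mult I J =
     {\<Sum>i<n. a i * b i | (n::nat) a b. (\<forall>i<n. a i \<in> I) \<and> (\<forall>i<n. b i \<in> J)}"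

definition ideal_group :: "'a::field_char_0 set \<Rightarrow> 'a set monoid" where
  "ideal_group K =
     \<lparr>carrier = {I. fractional_ideal K I \<and> I \<noteq> {0}},
      monoid.mult = fractional_ideal_mult,
      one = ring_of_integers K\<rparr>"

definition principal_ideals :: "'a::field_char_0 set \<Rightarrow> 'a set set" where
  "principal_ideals K = {(\<lambda>a. x * a) ` ring_of_integers K | x. x \<in> K \<and> x \<noteq> 0}"

definition class_group :: "'a::field_char_0 set \<Rightarrow> 'a set set monoid" where
  "class_group K = ideal_group K Mod principal_ideals K"

definition class_number :: "'a::field_char_0 set \<Rightarrow> nat" where
  "class_number K = Coset.order (class_group K)"

text \<open>Meant for finite \<open>G\<close>. An infinite \<open>G\<close> has \<open>order G = 0\<close>, so that only the trivial
  subgroup would qualify.\<close>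

definition sylow_subgroup :: "nat \<Rightarrow> 'g set \<Rightarrow> ('g, 'm) monoid_scheme \<Rightarrow> bool" where
  "sylow_subgroup q S G \<longleftrightarrow>
     subgroup S G \<and> card S = q ^ multiplicity q (Coset.order G)"

end

theory Submission
  imports Defs "HOL-Algebra.Group_Action" "HOL-Algebra.Sylow"
begin

text \<open>The Galois group \<open>G\<close> has order \<open>p ^ r\<close> by Artin's theorem, and it acts on the class group.
  If a class is fixed by \<open>G\<close>, then its \<open>p ^ r\<close>-th power is the class of the norm of one of its ideals,
  which is principal. Hence the only fixed point of \<open>G\<close> on a Sylow \<open>q\<close>-subgroup with \<open>q \<noteq> p\<close> is the
  trivial class, while all other orbits have size divisible by \<open>p\<close>.

  The norm of an integral ideal \<open>J\<close> is handled without prime factorisation, following Kronecker and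
  Hurwitz: if \<open>f\<close> is a polynomial whose coefficients generate \<open>J\<close>, then the product of the conjugates
  of \<open>f\<close> has integer coefficients, and by the multiplicativity of contents their gcd generates the
  product of the conjugates of \<open>J\<close>. This also yields the invertibility of ideals.\<close>

section \<open>Finitely generated additive groups and algebraic integers\<close>

text \<open>Over \<open>\<O>\<close> itself there are no gcds, so the content of a single polynomial
  is in general not principal. Once all conjugates are multiplied, the coefficients are both
  rational and integral, hence lie in \<int>, where the content is generated by one integer
  \<open>d\<close>. That \<open>d\<close> divides every product of elements of the conjugate ideals
  rests on Dedekind's extension of the Gauss lemma: if all coefficients of \<open>f * g\<close> are
  algebraic integers, then so is every product of a coefficient of \<open>f\<close> and a
  coefficient of \<open>g\<close>. The obstacle is the existence of \<open>f\<close>: a fractional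
  ideal is only required to have a common denominator, so finite generation of integral ideals has
  to be proved. This is done over \<int> with the help of the trace; spans over \<int> suffice
  because contents are only used as additive groups.\<close>

interpretation int_mod: Modules.module "\<lambda>(k::int) (x::'a::comm_ring_1). of_int k * x"
  by unfold_locales (simp_all add: algebra_simps)

definition fin_gen :: "'a::comm_ring_1 set \<Rightarrow> bool" where
  "fin_gen N \<longleftrightarrow> (\<exists>B. finite B \<and> int_mod.span B = N)"

lemma int_mod_subspaceI:
  assumes "0 \<in> N" "\<And>x y. x \<in> N \<Longrightarrow> y \<in> N \<Longrightarrow> x + y \<in> N" "\<And>x. x \<in> N \<Longrightarrow> - x \<in> N"
  shows "int_mod.subspace N"
proof (rule int_mod.subspaceI)
  fix c :: int and x assume x: "x \<in> N"
  have nat: "of_nat n * x \<in> N" for n :: nat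
    using assms x by (induction n) (auto simp: algebra_simps)
  show "of_int c * x \<in> N"
  proof (cases "c \<ge> 0")
    case True
    then show ?thesis using nat[of "nat c"] by simp
  next
    case False
    then have "of_int c * x = - (of_nat (nat (- c)) * x)" by simp
    then show ?thesis using nat[of "nat (- c)"] assms(3) by simp
  qed
qed (use assms in auto)

text \<open>The elements that \<open>c\<close> multiplies into \<open>S\<close> form an additive
  group, so it is enough to test generators.\<close>

lemma mult_mem_of_span:
  assumes "x \<in> int_mod.span B" "int_mod.subspace S" "\<And>b. b \<in> B \<Longrightarrow> c * b \<in> S"
  shows "c * x \<in> S"
proof -
  have "int_mod.subspace {x. c * x \<in> S}"
  proof (rule int_mod_subspaceI)
    show "- x \<in> {x. c * x \<in> S}" if "x \<in> {x. c * x \<in> S}" for x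
      using that int_mod.subspace_neg[OF assms(2), of "c * x"] by simp
  qed (use assms(2) in \<open>auto simp: int_mod.subspace_def distrib_left\<close>)
  then show ?thesis
    using int_mod.span_minimal[of B "{x. c * x \<in> S}"] assms by auto
qed

text \<open>Division by the least positive element leaves no remainder. This serves both the
  structure of finitely generated groups and the existence of the gcd of the coefficients of a
  norm.\<close>

lemma int_subgroup_cyclic:
  assumes "(0::int) \<in> H" "\<And>x y. x \<in> H \<Longrightarrow> y \<in> H \<Longrightarrow> x - y \<in> H"
  obtains d where "d \<in> H" "\<And>x. x \<in> H \<Longrightarrow> d dvd x"
proof (cases "H = {0}")
  case True
  then show thesis using that by auto
next
  case False
  have neg: "- x \<in> H" if "x \<in> H" for x using assms(2)[OF assms(1) that] by simp
  have add: "x + y \<in> H" if "x \<in> H" "y \<in> H" for x y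
    using assms(2)[OF that(1) neg[OF that(2)]] by simp
  have sub: "int_mod.subspace H"
    using assms(1) add neg by (intro int_mod_subspaceI) auto
  obtain x where x: "x \<in> H" "x \<noteq> 0" using False assms(1) by auto
  then have ex: "\<exists>n>0. int n \<in> H"
    using neg by (intro exI[of _ "nat \<bar>x\<bar>"]) (auto simp: abs_if)
  define n where "n = (LEAST n. n > 0 \<and> int n \<in> H)"
  have n: "n > 0" "int n \<in> H" using LeastI_ex[OF ex] by (auto simp: n_def)
  show thesis
  proof (rule that[OF n(2)])
    fix y assume y: "y \<in> H"
    have "y div int n * int n \<in> H"
      using int_mod.subspace_scale[OF sub n(2), of "y div int n"] by simp
    then have "y mod int n \<in> H"
      using assms(2)[OF y, of "y div int n * int n"] minus_div_mult_eq_mod[of y "int n"] by metis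
    then have "\<not> 0 < y mod int n"
      using not_less_Least[of "nat (y mod int n)" "\<lambda>n. n > 0 \<and> int n \<in> H"] n
      by (auto simp: n_def[symmetric] nat_less_iff)
    then have "y mod int n = 0"
      using n pos_mod_sign[of "int n" y] by linarith
    then show "int n dvd y" by (rule mod_0_imp_dvd)
  qed
qed

text \<open>The first components form the multiples of some \<open>d\<close>; one element
  \<open>m\<close> over \<open>d\<close>, together with generators of the fibre over 0, generates
  the image. A relation is used instead of a function because the coefficient of a generator need
  not be unique.\<close>

lemma fin_gen_snd_image:
  fixes P :: "(int \<times> 'a::comm_ring_1) set"
  assumes zero: "(0, 0) \<in> P"
    and diff: "\<And>j k x y. (j, x) \<in> P \<Longrightarrow> (k, y) \<in> P \<Longrightarrow> (j - k, x - y) \<in> P"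
    and fg: "fin_gen {x. (0, x) \<in> P}"
  shows "fin_gen (snd ` P)"
proof -
  obtain B where B: "finite B" "int_mod.span B = {x. (0, x) \<in> P}"
    using fg by (auto simp: fin_gen_def)
  have neg: "(- j, - x) \<in> P" if "(j, x) \<in> P" for j x using diff[OF zero that] by simp
  have add: "(j + k, x + y) \<in> P" if "(j, x) \<in> P" "(k, y) \<in> P" for j k x y
    using diff[OF that(1) neg[OF that(2)]] by simp
  have sub: "int_mod.subspace (snd ` P)"
  proof (rule int_mod_subspaceI)
    show "0 \<in> snd ` P" using zero by force
    show "x + y \<in> snd ` P" if "x \<in> snd ` P" "y \<in> snd ` P" for x y
      using that add by force
    show "- x \<in> snd ` P" if "x \<in> snd ` P" for x
      using that neg by force
  qed
  obtain d where d: "d \<in> fst ` P" "\<And>j. j \<in> fst ` P \<Longrightarrow> d dvd j"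
  proof (rule int_subgroup_cyclic[of "fst ` P"])
    show "0 \<in> fst ` P" using zero by force
    show "x - y \<in> fst ` P" if "x \<in> fst ` P" "y \<in> fst ` P" for x y
      using that diff by force
  qed blast
  obtain m where m: "(d, m) \<in> P" using d(1) by auto
  have mk: "(of_int k * d, of_int k * m) \<in> P" for k :: int
  proof -

    have nat: "(of_nat n * d, of_nat n * m) \<in> P" for n :: nat
    proof (induction n)
      case (Suc n)
      then show ?case using add[OF m, of "of_nat n * d" "of_nat n * m"] by (simp add: distrib_right)
    qed (use zero in simp)
    show ?thesis
    proof (cases "k \<ge> 0")
      case True
      then show ?thesis using nat[of "nat k"] by simp
    next
      case False
      then show ?thesis using neg[OF nat[of "nat (- k)"]] by simp
    qed
  qed
  have "int_mod.span (insert m B) = snd ` P"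
  proof (rule int_mod.span_subspace[OF _ _ sub])
    show "insert m B \<subseteq> snd ` P"
      using m int_mod.span_superset[of B] B(2) by force
    show "snd ` P \<subseteq> int_mod.span (insert m B)"
    proof
      fix x assume "x \<in> snd ` P"
      then obtain j where j: "(j, x) \<in> P" by auto
      then obtain k where k: "j = d * k" using d(2)[of j] by (force simp: dvd_def)
      have "(0, x - of_int k * m) \<in> P" using diff[OF j mk[of k]] k by simp
      then show "x \<in> int_mod.span (insert m B)"
        using B(2) int_mod.span_breakdown_eq by blast
    qed
  qed
  then show ?thesis using B(1) by (auto simp: fin_gen_def)
qed

text \<open>Induction on the generators: splitting off the coefficient of the new generator
  \<open>b\<close> leaves the part of \<open>N\<close> inside the span of the others.\<close>

lemma fin_gen_subspace:
  assumes "finite B" "int_mod.subspace N" "N \<subseteq> int_mod.span B"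
  shows "fin_gen N"
  using assms
proof (induction B arbitrary: N rule: finite_induct)
  case empty
  then have "int_mod.span {} = N" by (auto simp: int_mod.subspace_0)
  then show ?case unfolding fin_gen_def by blast
next
  case (insert b B)
  \<comment> \<open>All coefficients that \<open>b\<close> can have in some expression of
    \<open>x\<close> are collected, since relations between the generators make them
    ambiguous.\<close>
  let ?P = "{(k, x). x \<in> N \<and> x - of_int k * b \<in> int_mod.span B}"
  have "fin_gen (snd ` ?P)"
  proof (rule fin_gen_snd_image)
    show "(0, 0) \<in> ?P"
      using insert.prems by (auto simp: int_mod.subspace_0 int_mod.span_zero)
    show "(j - k, x - y) \<in> ?P" if "(j, x) \<in> ?P" "(k, y) \<in> ?P" for j k x y
    proof -
      have "x - y \<in> N" using that insert.prems by (auto intro: int_mod.subspace_diff)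
      moreover have "(x - y) - of_int (j - k) * b = (x - of_int j * b) - (y - of_int k * b)"
        by (simp add: algebra_simps)
      moreover have "(x - of_int j * b) - (y - of_int k * b) \<in> int_mod.span B"
        using that by (intro int_mod.span_diff[of "x - of_int j * b" _ "y - of_int k * b"]) auto
      ultimately show ?thesis by (simp only: mem_Collect_eq case_prod_conv)
    qed
    have "{x. (0, x) \<in> ?P} = N \<inter> int_mod.span B" by auto
    then show "fin_gen {x. (0, x) \<in> ?P}"
      using insert.IH[of "N \<inter> int_mod.span B"] insert.prems
      by (auto intro: int_mod.subspace_inter)
  qed
  moreover have "snd ` ?P = N"
    using insert.prems(2) int_mod.span_breakdown_eq[of _ b B] by (force simp: image_iff)
  ultimately show ?case by simp
qed

text \<open>The functionals \<open>f i\<close> jointly embed \<open>N\<close> into a power of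
  \<int>. The kernel of one of them is finitely generated by induction, and its image is
  cyclic.\<close>

lemma fin_gen_kernel:
  fixes f :: "'i \<Rightarrow> 'a::comm_ring_1 \<Rightarrow> int"
  assumes "finite A" "int_mod.subspace N"
    and "\<And>i x y. i \<in> A \<Longrightarrow> x \<in> N \<Longrightarrow> y \<in> N \<Longrightarrow> f i (x - y) = f i x - f i y"
    and "\<And>x. x \<in> N \<Longrightarrow> (\<And>i. i \<in> A \<Longrightarrow> f i x = 0) \<Longrightarrow> x = 0"
  shows "fin_gen N"
  using assms
proof (induction A arbitrary: N rule: finite_induct)
  case empty
  then have "int_mod.span {} = N" by (auto simp: int_mod.subspace_0)
  then show ?case unfolding fin_gen_def by blast
next
  case (insert a A)
  let ?P = "(\<lambda>x. (f a x, x)) ` N"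
  have f0: "f a 0 = 0"
    using insert.prems(2)[of a 0 0] insert.prems(1) by (auto simp: int_mod.subspace_0)
  have "fin_gen (snd ` ?P)"
  proof (rule fin_gen_snd_image)
    show "(0, 0) \<in> ?P"
      using insert.prems(1) f0 by (force simp: int_mod.subspace_0)
    show "(j - k, x - y) \<in> ?P" if "(j, x) \<in> ?P" "(k, y) \<in> ?P" for j k x y
      using that insert.prems(1,2) by (auto simp: int_mod.subspace_diff intro!: image_eqI)
    have "{x. (0, x) \<in> ?P} = {x \<in> N. f a x = 0}" by auto
    moreover have "fin_gen {x \<in> N. f a x = 0}"
    proof (rule insert.IH)
      have d: "x - y \<in> {x \<in> N. f a x = 0}" if "x \<in> {x \<in> N. f a x = 0}" "y \<in> {x \<in> N. f a x = 0}" for x y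
        using that insert.prems(1,2) by (auto simp: int_mod.subspace_diff)
      have z: "0 \<in> {x \<in> N. f a x = 0}"
        using insert.prems(1) f0 by (auto simp: int_mod.subspace_0)
      have n: "- x \<in> {x \<in> N. f a x = 0}" if "x \<in> {x \<in> N. f a x = 0}" for x
        using d[OF z that] by simp
      show "int_mod.subspace {x \<in> N. f a x = 0}"
        using z n d[OF _ n] by (intro int_mod_subspaceI) auto
      show "x = 0" if "x \<in> {x \<in> N. f a x = 0}" "\<And>i. i \<in> A \<Longrightarrow> f i x = 0" for x
        using insert.prems(3)[of x] that by auto
    qed (use insert.prems in auto)
    ultimately show "fin_gen {x. (0, x) \<in> ?P}" by simp
  qed
  moreover have "snd ` ?P = N" by force
  ultimately show ?case by simp
qed

section \<open>Integrality through finitely generated groups that are stable under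
  multiplication\<close>

lemma mem_span_powers:
  fixes x m :: "'a::comm_ring_1"
  assumes "y \<in> int_mod.span ((\<lambda>i. m * x ^ i) ` {..<k})"
  obtains c :: "nat \<Rightarrow> int" where "y = (\<Sum>i<k. of_int (c i) * (m * x ^ i))"
  using assms
proof (induction k arbitrary: y thesis)
  case 0
  then show ?case by simp
next
  case (Suc k)
  then obtain j where j: "y - of_int j * (m * x ^ k) \<in> int_mod.span ((\<lambda>i. m * x ^ i) ` {..<k})"
    using int_mod.span_breakdown_eq[of y "m * x ^ k"] by (auto simp: lessThan_Suc)
  obtain c :: "nat \<Rightarrow> int" where c: "y - of_int j * (m * x ^ k) = (\<Sum>i<k. of_int (c i) * (m * x ^ i))"
    using Suc.IH[OF _ j] by blast
  show ?case
    by (rule Suc.prems(1)[of "c(k := j)"]) (use c in \<open>simp add: algebra_simps\<close>)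
qed

text \<open>A noetherian argument in place of the determinant trick: the span of all
  \<open>m * x ^ i\<close> is a subgroup of \<open>M\<close>, hence finitely generated, hence
  spanned by finitely many of these elements. A later one is then a combination of the earlier ones,
  and cancelling \<open>m\<close> leaves a monic equation for \<open>x\<close>.\<close>

lemma algebraic_int_of_fin_gen:
  fixes x :: "'a::field"
  assumes "fin_gen M" "m \<in> M" "m \<noteq> 0" "\<And>y. y \<in> M \<Longrightarrow> x * y \<in> M"
  shows "algebraic_int x"
proof -
  obtain B where B: "finite B" "int_mod.span B = M" using assms(1) by (auto simp: fin_gen_def)
  let ?g = "\<lambda>i. m * x ^ i"
  have g: "?g i \<in> M" for i
  proof (induction i)
    case (Suc i)
    then show ?case using assms(4)[of "m * x ^ i"] by (simp add: mult.left_commute)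
  qed (use assms(2) in simp)
  have subM: "int_mod.subspace M" using B(2) by auto
  have "int_mod.span (range ?g) \<subseteq> int_mod.span B"
    unfolding B(2) by (rule int_mod.span_minimal[OF _ subM]) (use g in auto)
  then have "fin_gen (int_mod.span (range ?g))"
    by (rule fin_gen_subspace[OF B(1) int_mod.subspace_span])
  then obtain C where C: "finite C" "int_mod.span C = int_mod.span (range ?g)"
    unfolding fin_gen_def by blast
  have "\<exists>k. y \<in> int_mod.span (?g ` {..<k})" if y: "y \<in> int_mod.span (range ?g)" for y
  proof -
    obtain t r where t: "finite t" "t \<subseteq> range ?g" "y = (\<Sum>a\<in>t. of_int (r a) * a)"
      using y unfolding int_mod.span_explicit mem_Collect_eq by metis
    obtain I where I: "finite I" "t = ?g ` I"
      using finite_subset_image[OF t(1,2)] by blast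
    obtain k where k: "I \<subseteq> {..<k}" using finite_nat_iff_bounded[of I] I by auto
    have "t \<subseteq> int_mod.span (?g ` {..<k})"
      using image_mono[OF k, of ?g] int_mod.span_superset[of "?g ` {..<k}"] I(2) by blast
    then have "y \<in> int_mod.span (?g ` {..<k})"
      unfolding t(3) by (intro int_mod.span_sum int_mod.span_scale) auto
    then show ?thesis ..
  qed
  then have "\<forall>y\<in>C. \<exists>k. y \<in> int_mod.span (?g ` {..<k})"
    using C(2) int_mod.span_superset[of C] by blast
  then obtain k where k: "\<And>y. y \<in> C \<Longrightarrow> y \<in> int_mod.span (?g ` {..<k y})" by metis
  \<comment> \<open>The generator \<open>y\<close> only involves exponents below \<open>k y\<close>,
    and \<open>n\<close> bounds all of these; 0 is inserted so that the maximum also makes sense for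
    empty \<open>C\<close>.\<close>
  define n where "n = Max (insert 0 (k ` C))"
  have "C \<subseteq> int_mod.span (?g ` {..<n})"
  proof
    fix y assume y: "y \<in> C"
    have "k y \<le> n" using y C(1) by (simp add: n_def)
    then have "?g ` {..<k y} \<subseteq> ?g ` {..<n}" by auto
    then show "y \<in> int_mod.span (?g ` {..<n})"
      using k[OF y] int_mod.span_mono by blast
  qed
  then have "int_mod.span C \<subseteq> int_mod.span (?g ` {..<n})"
    by (rule int_mod.span_minimal) auto
  then have "?g n \<in> int_mod.span (?g ` {..<n})"
    using C(2) int_mod.span_superset[of "range ?g"] by blast
  then obtain c :: "nat \<Rightarrow> int" where c: "?g n = (\<Sum>i<n. of_int (c i) * ?g i)"
    using mem_span_powers by blast
  then have "m * x ^ n = m * (\<Sum>i<n. of_int (c i) * x ^ i)"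
    by (simp add: sum_distrib_left mult.left_commute)
  then have eq: "x ^ n = (\<Sum>i<n. of_int (c i) * x ^ i)" using assms(3) by simp
  define p :: "'a poly" where "p = monom 1 n - (\<Sum>i<n. monom (of_int (c i)) i)"
  have coeff: "coeff p i = (if i = n then 1 else if i < n then - of_int (c i) else 0)" for i
    by (auto simp: p_def coeff_sum coeff_diff)
  have "degree p = n"
    by (rule antisym[OF degree_le le_degree]) (auto simp: coeff)
  then show ?thesis
    by (intro algebraic_int.intros[of p])
      (auto simp: coeff, simp add: p_def poly_sum poly_monom eq)
qed

text \<open>\<open>M'\<close> is \<open>M + y M + ... + y ^ (n - 1) M\<close>, and the equation
  brings \<open>y ^ n M\<close> back into it. The \<open>c i\<close> are only asked to preserve
  \<open>M\<close>, which covers integers as well as algebraic integers as coefficients. The last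
  conclusion allows iteration: whatever preserves \<open>M\<close> also preserves
  \<open>M'\<close>.\<close>

lemma fin_gen_adjoin:
  fixes y :: "'a::field"
  assumes "fin_gen M" "y ^ n = (\<Sum>i<n. c i * y ^ i)"
    and cM: "\<And>i m. i < n \<Longrightarrow> m \<in> M \<Longrightarrow> c i * m \<in> M"
  obtains M' where "fin_gen M'" "M \<subseteq> M'" "\<And>m. m \<in> M' \<Longrightarrow> y * m \<in> M'"
    "\<And>a m. (\<And>x. x \<in> M \<Longrightarrow> a * x \<in> M) \<Longrightarrow> m \<in> M' \<Longrightarrow> a * m \<in> M'"
proof -
  obtain B where B: "finite B" "int_mod.span B = M" using assms(1) by (auto simp: fin_gen_def)
  define C where "C = (\<lambda>(i, b). y ^ i * b) ` ({..<n} \<times> B)"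
  define M' where "M' = int_mod.span C"
  have sub: "int_mod.subspace M'" by (simp add: M'_def)
  have yM: "y ^ i * m \<in> M'" if "i < n" "m \<in> M" for i m
  proof (rule mult_mem_of_span[of m B])
    show "y ^ i * b \<in> M'" if "b \<in> B" for b
      unfolding M'_def C_def using \<open>i < n\<close> that by (intro int_mod.span_base) auto
  qed (use B that sub in auto)
  \<comment> \<open>For \<open>n = 0\<close> the equation would read \<open>1 = 0\<close>.\<close>
  have n: "n > 0" using assms(2) by (cases n) auto
  show thesis
  proof (rule that)
    have "finite C" using B(1) by (simp add: C_def)
    then show "fin_gen M'" unfolding fin_gen_def M'_def by blast
    show "M \<subseteq> M'" using yM[of 0] n by auto
    show "y * m \<in> M'" if "m \<in> M'" for m
    proof (rule mult_mem_of_span[OF that[unfolded M'_def] sub])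
      fix b assume "b \<in> C"
      then obtain i b' where b: "b = y ^ i * b'" "i < n" "b' \<in> B" by (auto simp: C_def)
      have b': "b' \<in> M" using b B(2) int_mod.span_base by blast
      show "y * b \<in> M'"
      proof (cases "Suc i < n")
        case True
        then show ?thesis using yM[OF True b'] b by (simp add: mult.assoc)
      next
        case False
        then have "Suc i = n" using b by simp
        then have "y * b = y ^ n * b'" using b by auto
        also have "\<dots> = (\<Sum>i<n. y ^ i * (c i * b'))"
          unfolding assms(2) by (simp add: sum_distrib_right mult.left_commute mult.assoc)
        also have "\<dots> \<in> M'"
          using yM cM b' by (intro int_mod.subspace_sum[OF sub]) auto
        finally show ?thesis .
      qed
    qed
    show "a * m \<in> M'" if "\<And>x. x \<in> M \<Longrightarrow> a * x \<in> M" "m \<in> M'" for a m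
    proof (rule mult_mem_of_span[OF that(2)[unfolded M'_def] sub])
      fix b assume "b \<in> C"
      then obtain i b' where b: "b = y ^ i * b'" "i < n" "b' \<in> B" by (auto simp: C_def)
      have "b' \<in> M" using b B(2) int_mod.span_base by blast
      then show "a * b \<in> M'" using yM[OF b(2) that(1)] b(1) by (simp add: mult.left_commute)
    qed
  qed
qed

lemma algebraic_int_power_eq:
  fixes x :: "'a::field_char_0"
  assumes "algebraic_int x"
  obtains n and c :: "nat \<Rightarrow> int" where "x ^ n = (\<Sum>i<n. of_int (c i) * x ^ i)"
proof -
  obtain p :: "int poly" where p: "poly (map_poly of_int p) x = 0" "lead_coeff p = 1"
    using assms algebraic_int_altdef_ipoly[of x] by auto
  have "0 = (\<Sum>i\<le>degree p. of_int (coeff p i) * x ^ i)"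
    using p(1) by (simp add: poly_altdef coeff_map_poly degree_map_poly)
  also have "\<dots> = (\<Sum>i<degree p. of_int (coeff p i) * x ^ i) + x ^ degree p"
    using p(2) by (simp flip: lessThan_Suc_atMost)
  finally have "x ^ degree p = (\<Sum>i<degree p. of_int (- coeff p i) * x ^ i)"
    by (simp add: sum_negf eq_neg_iff_add_eq_0 add.commute)
  then show thesis using that[of "degree p" "\<lambda>i. - coeff p i"] by blast
qed

text \<open>Elements are adjoined one at a time. The clause \<open>1 \<in> M\<close> later provides
  the non-zero element that \<open>algebraic_int_of_fin_gen\<close> asks for.\<close>

lemma fin_gen_stable:
  fixes C :: "'a::field_char_0 set"
  assumes "finite C" "\<And>c. c \<in> C \<Longrightarrow> algebraic_int c"
  shows "\<exists>M. fin_gen M \<and> 1 \<in> M \<and> (\<forall>c\<in>C. \<forall>m\<in>M. c * m \<in> M)"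
  using assms
proof (induction C rule: finite_induct)
  case empty
  have "1 \<in> int_mod.span {1::'a}" by (rule int_mod.span_base) simp
  then show ?case by (intro exI[of _ "int_mod.span {1}"]) (auto simp: fin_gen_def)
next
  case (insert y C)
  then obtain M where M: "fin_gen M" "1 \<in> M" "\<forall>c\<in>C. \<forall>m\<in>M. c * m \<in> M" by auto
  obtain n and c :: "nat \<Rightarrow> int" where c: "y ^ n = (\<Sum>i<n. of_int (c i) * y ^ i)"
    using algebraic_int_power_eq insert.prems by blast
  have "of_int (c i) * m \<in> M" if "m \<in> M" for i m
    using M(1) that int_mod.span_scale by (auto simp: fin_gen_def)
  then obtain M' where M': "fin_gen M'" "M \<subseteq> M'" "\<And>m. m \<in> M' \<Longrightarrow> y * m \<in> M'"
    "\<And>a m. (\<And>x. x \<in> M \<Longrightarrow> a * x \<in> M) \<Longrightarrow> m \<in> M' \<Longrightarrow> a * m \<in> M'"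
    by (rule fin_gen_adjoin[OF M(1) c]) blast+
  then show ?case using M by (intro exI[of _ M']) auto
qed

text \<open>Transitivity of integrality: the coefficients preserve a common finitely generated
  group, which can be enlarged to one that \<open>y\<close> preserves too.\<close>

lemma algebraic_int_integral_root:
  fixes y :: "'a::field_char_0"
  assumes "y ^ n = (\<Sum>i<n. c i * y ^ i)" "\<And>i. i < n \<Longrightarrow> algebraic_int (c i)"
  shows "algebraic_int y"
proof -
  obtain M where M: "fin_gen M" "1 \<in> M" "\<forall>c\<in>c ` {..<n}. \<forall>m\<in>M. c * m \<in> M"
    using fin_gen_stable[of "c ` {..<n}"] assms(2) by auto
  obtain M' where M': "fin_gen M'" "M \<subseteq> M'" "\<And>m. m \<in> M' \<Longrightarrow> y * m \<in> M'"
    by (rule fin_gen_adjoin[OF M(1) assms(1)]) (use M in blast)+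
  then show ?thesis
    using algebraic_int_of_fin_gen[of M' 1 y] M by auto
qed

text \<open>A finitely generated group preserved by \<open>x\<close> and by \<open>y\<close> is
  preserved by their sum and product.\<close>

lemma algebraic_int_add_mult:
  fixes x y :: "'a::field_char_0"
  assumes "algebraic_int x" "algebraic_int y"
  shows algebraic_int_add: "algebraic_int (x + y)" and algebraic_int_mult: "algebraic_int (x * y)"
proof -
  obtain M where M: "fin_gen M" "1 \<in> M" "\<forall>c\<in>{x, y}. \<forall>m\<in>M. c * m \<in> M"
    using fin_gen_stable[of "{x, y}"] assms by auto
  have "(x + y) * m \<in> M" "(x * y) * m \<in> M" if "m \<in> M" for m
    using M that by (auto simp: fin_gen_def distrib_right mult.assoc intro: int_mod.span_add)
  then show "algebraic_int (x + y)" "algebraic_int (x * y)"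
    using algebraic_int_of_fin_gen[OF M(1,2), of "x + y"]
      algebraic_int_of_fin_gen[OF M(1,2), of "x * y"] by auto
qed

lemma algebraic_int_diff:
  fixes x y :: "'a::field_char_0"
  assumes "algebraic_int x" "algebraic_int y"
  shows "algebraic_int (x - y)"
  using algebraic_int_add[of x "- y"] assms by simp

lemma algebraic_int_sum:
  fixes f :: "'b \<Rightarrow> 'a::field_char_0"
  assumes "\<And>x. x \<in> A \<Longrightarrow> algebraic_int (f x)"
  shows "algebraic_int (sum f A)"
  using assms by (induction A rule: infinite_finite_induct) (auto intro: algebraic_int_add)

lemma algebraic_int_power:
  fixes x :: "'a::field_char_0"
  assumes "algebraic_int x"
  shows "algebraic_int (x ^ n)"
  using assms by (induction n) (auto intro: algebraic_int_mult)

section \<open>Contents of products of polynomials\<close>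

lemma subspace_algebraic_int: "int_mod.subspace {x::'a::field_char_0. algebraic_int x}"
  by (rule int_mod_subspaceI) (auto intro: algebraic_int_add)

text \<open>With \<open>l\<close> the leading coefficient and \<open>n\<close> the degree,
  multiplying the equation for \<open>a\<close> by \<open>l ^ (n - 1)\<close> turns it into a monic
  equation for \<open>l * a\<close> with coefficients \<open>coeff f i * l ^ (n - 1 - i)\<close>, up
  to sign.\<close>

lemma algebraic_int_lead_coeff_mult_root:
  fixes f :: "'a::field_char_0 poly"
  assumes "\<And>i. algebraic_int (coeff f i)" "poly f a = 0"
  shows "algebraic_int (lead_coeff f * a)"
proof (cases "degree f = 0")
  case True
  then have "coeff f 0 = 0" using assms(2) by (simp add: poly_altdef)
  with True show ?thesis by simp
next
  case False
  define n where "n = degree f"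
  define l where "l = lead_coeff f"
  have n: "n > 0" using False by (simp add: n_def)
  have "0 = (\<Sum>i<n. coeff f i * a ^ i) + l * a ^ n"
    using assms(2) unfolding poly_altdef n_def l_def by (simp flip: lessThan_Suc_atMost)
  then have "l * a ^ n = - (\<Sum>i<n. coeff f i * a ^ i)" by (simp add: eq_neg_iff_add_eq_0 add.commute)
  moreover have "(l * a) ^ n = l ^ (n - 1) * (l * a ^ n)"
    using n by (cases n) (auto simp: power_mult_distrib)
  ultimately have "(l * a) ^ n = (\<Sum>i<n. - (l ^ (n - 1) * (coeff f i * a ^ i)))"
    by (simp add: sum_distrib_left sum_negf)
  also have "\<dots> = (\<Sum>i<n. - (coeff f i * l ^ (n - 1 - i)) * (l * a) ^ i)"
  proof (rule sum.cong)
    fix i assume "i \<in> {..<n}"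
    then have "l ^ (n - 1) = l ^ (n - 1 - i) * l ^ i" by (simp flip: power_add)
    then show "- (l ^ (n - 1) * (coeff f i * a ^ i)) = - (coeff f i * l ^ (n - 1 - i)) * (l * a) ^ i"
      by (simp add: power_mult_distrib)
  qed simp
  finally show ?thesis
    unfolding l_def[symmetric]
    by (rule algebraic_int_integral_root)
      (auto intro!: algebraic_int_mult algebraic_int_power assms(1) simp: l_def)
qed

text \<open>Coefficients of \<open>h\<close> are stripped from the top. A non-zero top coefficient
  \<open>c\<close> is the leading coefficient of \<open>[:- a, 1:] * h\<close>, so \<open>c\<close>
  is integral, and so is \<open>a * c\<close> because \<open>a\<close> is a root. Removing
  \<open>c\<close> from \<open>h\<close> changes the product only by the integral coefficients
  \<open>c\<close> and \<open>a * c\<close>. Here \<open>n\<close> merely bounds the degree, so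
  \<open>c\<close> may also be zero.\<close>

lemma algebraic_int_coeff_div_root:
  fixes h :: "'a::field_char_0 poly"
  assumes "\<And>i. i \<ge> n \<Longrightarrow> coeff h i = 0" "\<And>i. algebraic_int (coeff ([:- a, 1:] * h) i)"
  shows "algebraic_int (coeff h i) \<and> algebraic_int (a * coeff h i)"
  using assms
proof (induction n arbitrary: h i)
  case (Suc n)
  let ?f = "[:- a, 1:] * h"
  define c where "c = coeff h n"
  have cc: "algebraic_int c \<and> algebraic_int (a * c)"
  proof (cases "c = 0")
    case False
    then have deg: "degree h = n"
      using Suc.prems(1) by (intro antisym degree_le le_degree) (auto simp: c_def)
    have "lead_coeff ?f = c" unfolding lead_coeff_mult using deg by (simp add: c_def)
    moreover have "poly ?f a = 0" by simp
    ultimately show ?thesis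
      using algebraic_int_lead_coeff_mult_root[OF Suc.prems(2)] Suc.prems(2)[of "degree ?f"]
      by (simp add: mult.commute)
  qed auto
  define h' where "h' = h - monom c n"
  have h: "coeff h i = coeff h' i + (if i = n then c else 0)" for i
    by (simp add: h'_def)
  have "algebraic_int (coeff h' i) \<and> algebraic_int (a * coeff h' i)" for i
  proof (rule Suc.IH)
    show "coeff h' i = 0" if "n \<le> i" for i
      using Suc.prems(1)[of i] that by (cases "i = n") (auto simp: h'_def c_def)
    fix i
    have "[:- a, 1:] * h' = ?f - monom c (Suc n) + monom (a * c) n"
      by (rule poly_eqI) (simp add: h'_def coeff_pCons right_diff_distrib split: nat.split)
    then show "algebraic_int (coeff ([:- a, 1:] * h') i)"
      using Suc.prems(2)[of i] cc
      by (auto simp del: mult_pCons_left intro!: algebraic_int_add algebraic_int_diff)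
  qed
  then show ?case
    using cc by (auto simp: h distrib_left intro!: algebraic_int_add)
qed auto

text \<open>If \<open>f = (X - a) h\<close>, then both \<open>h g\<close> and \<open>a h g\<close> have integral coefficients, so that the
  induction hypothesis applies to \<open>h\<close> and to \<open>a h\<close>.\<close>

lemma algebraic_int_coeff_mult_coeff_aux:
  fixes f g :: "'a::{alg_closed_field, field_char_0} poly"
  assumes "degree f \<le> n" "\<And>i. algebraic_int (coeff (f * g) i)"
  shows "algebraic_int (coeff f i * coeff g j)"
  using assms
proof (induction n arbitrary: f i)
  case 0
  then obtain c where "f = [:c:]" using degree_eq_zeroE by auto
  then show ?case using "0.prems"(2)[of j] by (cases i) auto
next
  case (Suc n)
  show ?case
  proof (cases "degree f = 0")
    case True
    then show ?thesis using Suc.IH[OF _ Suc.prems(2)] by auto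
  next
    case False
    then obtain a where "poly f a = 0" using alg_closed_imp_poly_has_root[of f] by auto
    then obtain h where h: "f = [:- a, 1:] * h" using poly_eq_0_iff_dvd by (auto simp: dvd_def)
    have "h \<noteq> 0" using False h by auto
    then have deg: "degree h \<le> n"
      using Suc.prems(1) unfolding h by (subst (asm) degree_mult_eq) auto
    have int: "algebraic_int (coeff (h * g) k) \<and> algebraic_int (a * coeff (h * g) k)" for k
    proof (rule algebraic_int_coeff_div_root)
      show "coeff (h * g) i = 0" if "Suc (degree (h * g)) \<le> i" for i
        using that by (auto intro: coeff_eq_0)
      show "algebraic_int (coeff ([:- a, 1:] * (h * g)) i)" for i
        using Suc.prems(2)[of i] unfolding h mult.assoc .
    qed
    have 1: "algebraic_int (coeff h k * coeff g j)" for k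
      using Suc.IH[OF deg] int by blast
    have 2: "algebraic_int (a * coeff h k * coeff g j)" for k
      using Suc.IH[of "smult a h" k] int deg by (auto intro: order_trans[OF degree_smult_le])
    have "coeff f i = (case i of 0 \<Rightarrow> 0 | Suc k \<Rightarrow> coeff h k) - a * coeff h i"
      by (simp add: h coeff_pCons split: nat.splits)
    then show ?thesis
      using 1 2 algebraic_int_diff[OF 1 2]
      by (auto simp: left_diff_distrib split: nat.splits)
  qed
qed

text \<open>\<open>to_ac\<close> embeds the ambient field into an algebraic closure, where
  polynomials split; the same integer polynomials vanish at an element and at its image.\<close>

lemma algebraic_int_to_ac_iff: "algebraic_int (to_ac x) \<longleftrightarrow> algebraic_int (x :: 'a::field_char_0)"
proof -
  have "poly (map_poly of_int p) (to_ac x) = to_ac (poly (map_poly of_int p) x)" for p :: "int poly"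
    by (simp add: poly_altdef degree_map_poly coeff_map_poly to_ac_sum)
  then show ?thesis by (simp add: algebraic_int_altdef_ipoly)
qed

text \<open>Dedekind's extension of the Gauss lemma. Linear factors are split off in the algebraic
  closure, and the conclusion descends along \<open>to_ac\<close>.\<close>

lemma algebraic_int_coeff_mult_coeff:
  fixes f g :: "'a::field_char_0 poly"
  assumes "\<And>i. algebraic_int (coeff (f * g) i)"
  shows "algebraic_int (coeff f i * coeff g j)"
proof -
  let ?t = "map_poly to_ac :: 'a poly \<Rightarrow> _"
  have "?t (f * g) = ?t f * ?t g"
    by (rule poly_eqI) (simp add: coeff_map_poly coeff_mult to_ac_sum)
  moreover have "algebraic_int (coeff (?t (f * g)) i)" for i
    using assms by (simp add: coeff_map_poly algebraic_int_to_ac_iff)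
  ultimately have "algebraic_int (coeff (?t f) i * coeff (?t g) j)"
    using algebraic_int_coeff_mult_coeff_aux[of "?t f" "degree (?t f)" "?t g"] by simp
  then show ?thesis
    by (simp add: coeff_map_poly algebraic_int_to_ac_iff flip: to_ac_mult)
qed

text \<open>One polynomial at a time is exchanged for an element of the \<int>-span of its
  coefficients. The scalar \<open>e\<close> varies in the induction because it absorbs the elements
  already exchanged; its intended initial value is the inverse of the content of the
  product.\<close>

lemma algebraic_int_prod_content:
  fixes f :: "'i \<Rightarrow> 'a::field_char_0 poly"
  assumes "finite A" "\<And>i. algebraic_int (e * coeff (\<Prod>s\<in>A. f s) i)"
    "\<And>s. s \<in> A \<Longrightarrow> x s \<in> int_mod.span (range (coeff (f s)))"
  shows "algebraic_int (e * (\<Prod>s\<in>A. x s))"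
  using assms
proof (induction A arbitrary: e rule: finite_induct)
  case empty
  then show ?case using empty(1)[of 0] by simp
next
  case (insert s A)
  let ?P = "\<Prod>s\<in>A. f s"
  have "algebraic_int (coeff (smult e (f s)) i * coeff ?P j)" for i j
    by (rule algebraic_int_coeff_mult_coeff) (use insert.prems(1) insert.hyps in simp)
  then have c: "algebraic_int (e * coeff ?P j * coeff (f s) i)" for i j
    by (simp add: mult_ac)
  have "e * coeff ?P j * x s \<in> {x. algebraic_int x}" for j
    by (rule mult_mem_of_span[OF insert.prems(2) subspace_algebraic_int]) (use c in auto)
  then have "algebraic_int (e * x s * (\<Prod>s\<in>A. x s))"
    using insert.IH[of "e * x s"] insert.prems(2) by (simp add: mult_ac)
  then show ?case using insert.hyps by (simp add: mult_ac)
qed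

section \<open>Groups of prime power order acting on Sylow subgroups\<close>

lemma (in group_action) orbit_subset: "x \<in> E \<Longrightarrow> orbit G \<phi> x \<subseteq> E"
  using element_image by (auto simp: orbit_def)

text \<open>An orbit outside the fixed points has a size that divides \<open>p ^ r\<close> and
  differs from 1.\<close>

lemma (in group_action) card_cong_fixed_points:
  assumes "prime p" "Coset.order G = p ^ r" "finite E"
  shows "[card E = card {x \<in> E. \<forall>g\<in>carrier G. \<phi> g x = x}] (mod p)"
proof -
  define F where "F = {x \<in> E. \<forall>g\<in>carrier G. \<phi> g x = x}"
  let ?C = "orbit G \<phi> ` (E - F)"
  have part: "orbit G \<phi> x \<inter> orbit G \<phi> y = {}"
    if "x \<in> E" "y \<in> E" "orbit G \<phi> x \<noteq> orbit G \<phi> y" for x y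
    using disjoint_union[of "orbit G \<phi> x" "orbit G \<phi> y"] that by (auto simp: orbits_def)
  have refl: "x \<in> orbit G \<phi> x" if "x \<in> E" for x
    using orbit_refl that by blast
  have fixed: "orbit G \<phi> x = {x}" if "x \<in> F" for x
    using that refl[of x] by (auto simp: orbit_def F_def)
  have "\<Union>?C = E - F"
  proof
    show "E - F \<subseteq> \<Union>?C" using refl by blast
    show "\<Union>?C \<subseteq> E - F"
    proof
      fix y assume "y \<in> \<Union>?C"
      then obtain x where x: "x \<in> E - F" "y \<in> orbit G \<phi> x" by blast
      then have y: "y \<in> E" using orbit_subset by blast
      then have "orbit G \<phi> x = orbit G \<phi> y"
        using part[of x y] x refl[of y] by blast
      then have "y \<notin> F" using fixed[of y] x refl[of x] by auto
      then show "y \<in> E - F" using y by simp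
    qed
  qed
  moreover have "p dvd card (\<Union>?C)"
  proof (rule dvd_partition)
    show "finite (\<Union>?C)" using \<open>\<Union>?C = E - F\<close> assms(3) by simp
    show "\<forall>c\<in>?C. p dvd card c"
    proof (rule ballI)
      fix c assume "c \<in> ?C"
      then obtain x where x: "x \<in> E" "x \<notin> F" "c = orbit G \<phi> x" by blast
      have "card c dvd p ^ r"
        using orbit_stabilizer_theorem[OF x(1)] x(3) assms(2) by (metis dvd_triv_left)
      then obtain i where i: "card c = p ^ i"
        using assms(1) divides_primepow_nat by blast
      have "i \<noteq> 0"
      proof
        assume "i = 0"
        then obtain z where "c = {z}" using i card_1_singletonE by auto
        then have "c = {x}" using refl[OF x(1)] x(3) by auto
        then have "x \<in> F" using x by (auto simp: F_def orbit_def)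
        then show False using x(2) by simp
      qed
      then show "p dvd card c" using i by simp
    qed
    show "\<forall>c1\<in>?C. \<forall>c2\<in>?C. c1 \<noteq> c2 \<longrightarrow> c1 \<inter> c2 = {}" using part by blast
  qed
  moreover have "card E = card (E - F) + card F"
    using assms(3) by (subst card_Diff_subset) (auto simp: F_def card_mono)
  ultimately have "[card E = card F] (mod p)"
    by (simp add: cong_add_rcancel_0_nat cong_0_iff)
  then show ?thesis by (simp add: F_def)
qed

text \<open>The quotient by \<open>S\<close> has order prime to \<open>q\<close>, so an element
  killed by a power of \<open>q\<close> becomes trivial there. Since \<open>S\<close> is thereby
  described by an equation, every endomorphism of \<open>G\<close> maps \<open>S\<close> into
  itself.\<close>

lemma (in comm_group) mem_sylow_subgroup_iff:
  assumes "finite (carrier G)" "prime q" "sylow_subgroup q S G" "x \<in> carrier G"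
  shows "x \<in> S \<longleftrightarrow> x [^] (q ^ multiplicity q (Coset.order G)) = \<one>"
proof
  let ?n = "q ^ multiplicity q (Coset.order G)"
  have S: "subgroup S G" "card S = ?n" using assms(3) by (auto simp: sylow_subgroup_def)
  {
    assume x: "x \<in> S"
    interpret S: group "G\<lparr>carrier := S\<rparr>" using subgroup.subgroup_is_group[OF S(1) is_group] .
    have "x [^]\<^bsub>G\<lparr>carrier := S\<rparr>\<^esub> Coset.order (G\<lparr>carrier := S\<rparr>) = \<one>\<^bsub>G\<lparr>carrier := S\<rparr>\<^esub>"
      using x by (intro S.pow_order_eq_1) simp
    then show "x [^] ?n = \<one>"
      using S(2) by (simp add: Coset.order_def flip: nat_pow_consistent)
  }
  assume x: "x [^] ?n = \<one>"
  have nS: "S \<lhd> G" using S(1) by (rule subgroup_imp_normal)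
  interpret Q: group "G Mod S" using normal.factorgroup_is_group[OF nS] .
  have "Coset.order (G Mod S) * ?n = Coset.order G"
    using lagrange[OF S(1)] S(2) by (simp add: Coset.order_def FactGroup_def)
  moreover have "Coset.order G \<noteq> 0" using assms(1) order_gt_0_iff_finite by simp
  \<comment> \<open>\<open>?n\<close> is the full power of \<open>q\<close> in the order of the
    group, so the index of \<open>S\<close> is prime to it.\<close>
  ultimately have cop: "coprime ?n (Coset.order (G Mod S))"
    using assms(2) by (metis coprime_power_left_iff multiplicity_decompose' 
        mult.commute nonzero_mult_div_cancel_left not_prime_unit prime_imp_coprime
        multiplicity_decompose zero_neq_one mult_is_0)
  have xS: "S #> x \<in> carrier (G Mod S)" using assms(4) by (auto simp: FactGroup_def RCOSETS_def)
  have hom: "(\<lambda>a. S #> a) \<in> hom G (G Mod S)" using normal.r_coset_hom_Mod[OF nS] .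
  interpret h: group_hom G "G Mod S" "\<lambda>a. S #> a"
    using hom by unfold_locales
  have "(S #> x) [^]\<^bsub>G Mod S\<^esub> ?n = \<one>\<^bsub>G Mod S\<^esub>"
    using h.hom_nat_pow[OF assms(4), of ?n] x h.hom_one by simp
  then have "Q.ord (S #> x) dvd ?n" using Q.pow_eq_id[OF xS] by simp
  moreover have "Q.ord (S #> x) dvd Coset.order (G Mod S)" using Q.ord_dvd_group_order[OF xS] .
  ultimately have "Q.ord (S #> x) = 1" using cop by (metis coprime_common_divisor_nat One_nat_def)
  then have "S #> x = S" using Q.ord_eq_1[OF xS] by (simp add: FactGroup_def)
  then show "x \<in> S" using rcos_self[OF assms(4) S(1)] by simp
qed

text \<open>The assumption \<open>fixed\<close> is where the arithmetic enters: a fixed element of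
  \<open>S\<close> then has order dividing both \<open>p ^ r\<close> and a power of
  \<open>q\<close>, hence order 1.\<close>

lemma (in comm_group) card_sylow_subgroup_cong_1:
  assumes G: "finite (carrier G)"
    and p: "prime p" and q: "prime q" and "p \<noteq> q"
    and H: "group H" "Coset.order H = p ^ r"
    and act: "\<And>h. h \<in> carrier H \<Longrightarrow> \<psi> h \<in> hom G G"
    and act_one: "\<And>x. x \<in> carrier G \<Longrightarrow> \<psi> \<one>\<^bsub>H\<^esub> x = x"
    and act_mult: "\<And>h k x. h \<in> carrier H \<Longrightarrow> k \<in> carrier H \<Longrightarrow> x \<in> carrier G \<Longrightarrow>
      \<psi> (h \<otimes>\<^bsub>H\<^esub> k) x = \<psi> h (\<psi> k x)"
    and fixed: "\<And>x. x \<in> carrier G \<Longrightarrow> (\<And>h. h \<in> carrier H \<Longrightarrow> \<psi> h x = x) \<Longrightarrow> x [^] (p ^ r) = \<one>"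
    and S: "sylow_subgroup q S G"
  shows "[card S = 1] (mod p)"
proof -
  interpret H: group H by (rule H(1))
  let ?n = "q ^ multiplicity q (Coset.order G)"
  have sub: "subgroup S G" using S by (simp add: sylow_subgroup_def)
  have SG: "S \<subseteq> carrier G" using subgroup.subset[OF sub] .
  have finS: "finite S" using SG G finite_subset by blast
  note mem = mem_sylow_subgroup_iff[OF G q S]
  have closed: "\<psi> h x \<in> S" if h: "h \<in> carrier H" and x: "x \<in> S" for h x
  proof -
    interpret h: group_hom G G "\<psi> h" using act[OF h] by unfold_locales
    have xG: "x \<in> carrier G" using x SG by auto
    have "\<psi> h x [^] ?n = \<one>"
      using h.hom_nat_pow[OF xG, of ?n] mem[OF xG] x h.hom_one by simp
    then show ?thesis using mem[of "\<psi> h x"] h.hom_closed[OF xG] by simp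
  qed
  \<comment> \<open>The elements of \<open>BijGroup S\<close> are functions that are
    \<open>undefined\<close> outside \<open>S\<close>, hence the restriction.\<close>
  let ?\<phi> = "\<lambda>h. restrict (\<psi> h) S"
  have inv: "\<psi> (inv\<^bsub>H\<^esub> h) (\<psi> h x) = x" "\<psi> h (\<psi> (inv\<^bsub>H\<^esub> h) x) = x"
    if "h \<in> carrier H" "x \<in> S" for h x
    using act_mult[of "inv\<^bsub>H\<^esub> h" h x] act_mult[of h "inv\<^bsub>H\<^esub> h" x] act_one[of x] that SG by auto
  have bij: "?\<phi> h \<in> Bij S" if "h \<in> carrier H" for h
  proof -
    have "bij_betw (\<psi> h) S S"
      using that closed inv by (intro bij_betw_byWitness[of _ "\<psi> (inv\<^bsub>H\<^esub> h)"]) auto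
    then show ?thesis by (simp add: Bij_def)
  qed
  have "group_hom H (BijGroup S) ?\<phi>"
  proof (intro group_hom.intro H(1) group_BijGroup group_hom_axioms.intro homI)
    show "?\<phi> h \<in> carrier (BijGroup S)" if "h \<in> carrier H" for h
      using bij[OF that] by (simp add: BijGroup_def)
    show "?\<phi> (h \<otimes>\<^bsub>H\<^esub> k) = ?\<phi> h \<otimes>\<^bsub>BijGroup S\<^esub> ?\<phi> k" if hk: "h \<in> carrier H" "k \<in> carrier H" for h k
    proof -
      have "\<psi> (h \<otimes>\<^bsub>H\<^esub> k) x = \<psi> h (\<psi> k x)" if "x \<in> S" for x
        using act_mult[OF hk] that SG by auto
      then show ?thesis
        using bij hk closed by (auto simp: BijGroup_def compose_def restrict_def fun_eq_iff)
    qed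
  qed
  then interpret group_action H S ?\<phi> by (rule group_action.intro)
  have "{x \<in> S. \<forall>h\<in>carrier H. ?\<phi> h x = x} = {\<one>}"
  proof
    show "{\<one>} \<subseteq> {x \<in> S. \<forall>h\<in>carrier H. ?\<phi> h x = x}"
      using subgroup.one_closed[OF sub] hom_one[OF act] is_group by auto
    show "{x \<in> S. \<forall>h\<in>carrier H. ?\<phi> h x = x} \<subseteq> {\<one>}"
    proof
      fix x assume x: "x \<in> {x \<in> S. \<forall>h\<in>carrier H. ?\<phi> h x = x}"
      then have xG: "x \<in> carrier G" using SG by auto
      have "x [^] (p ^ r) = \<one>" using fixed[OF xG] x by auto
      then have "ord x dvd p ^ r" using pow_eq_id[OF xG] by simp
      moreover have "ord x dvd ?n" using mem[OF xG] x pow_eq_id[OF xG] by simp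
      moreover have "coprime (p ^ r) ?n" using p q \<open>p \<noteq> q\<close> by (simp add: primes_coprime)
      ultimately have "ord x = 1" by (metis coprime_common_divisor_nat One_nat_def)
      then show "x \<in> {\<one>}" using ord_eq_1[OF xG] by simp
    qed
  qed
  then show ?thesis using card_cong_fixed_points[OF p H(2) finS] by simp
qed

section \<open>Galois number fields\<close>

text \<open>Gaussian elimination. The closure conditions describe a subfield \<open>L\<close>, and
  elimination never leaves the subfield of the coefficients. It is applied to the whole ambient
  field and to \<open>K\<close>, giving the two inequalities of Artin's theorem.\<close>

lemma homogeneous_system_nontrivial_solution:
  fixes a :: "'i \<Rightarrow> 'j \<Rightarrow> 'a::field"
  assumes L: "0 \<in> L" "1 \<in> L" "\<And>x y. x \<in> L \<Longrightarrow> y \<in> L \<Longrightarrow> x - y \<in> L"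
      "\<And>x y. x \<in> L \<Longrightarrow> y \<in> L \<Longrightarrow> x * y \<in> L" "\<And>x. x \<in> L \<Longrightarrow> inverse x \<in> L"
    and "finite I" "finite J" "card I < card J" "\<And>i j. i \<in> I \<Longrightarrow> j \<in> J \<Longrightarrow> a i j \<in> L"
  shows "\<exists>x. (\<forall>j\<in>J. x j \<in> L) \<and> (\<exists>j\<in>J. x j \<noteq> 0) \<and> (\<forall>i\<in>I. (\<Sum>j\<in>J. a i j * x j) = 0)"
  using assms(6-)
proof (induction I arbitrary: J a rule: finite_induct)
  case empty
  then have "J \<noteq> {}" by auto
  then show ?case using L by (intro exI[of _ "\<lambda>_. 1"]) auto
next
  case (insert k I)
  show ?case
  proof (cases "\<forall>j\<in>J. a k j = 0")
    case True
    then show ?thesis using insert.IH[of J a] insert.prems insert.hyps by auto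
  next
    case False
    then obtain l where l: "l \<in> J" "a k l \<noteq> 0" by auto
    have Lm: "- x \<in> L" if "x \<in> L" for x using L(3)[OF L(1) that] by simp
    have La: "x + y \<in> L" if "x \<in> L" "y \<in> L" for x y using L(3)[OF that(1) Lm[OF that(2)]] by simp
    \<comment> \<open>Row \<open>i\<close> after the pivot row \<open>k\<close> has been used to
      clear column \<open>l\<close>.\<close>
    define b where "b i j = a i j - a i l * (a k j * inverse (a k l))" for i j
    have "card I < card (J - {l})" using insert l(1) by auto
    moreover have "b i j \<in> L" if "i \<in> I" "j \<in> J - {l}" for i j
      unfolding b_def using L insert.prems(3) that l(1) by auto
    ultimately obtain x where x: "\<forall>j\<in>J - {l}. x j \<in> L" "\<exists>j\<in>J - {l}. x j \<noteq> 0"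
      "\<forall>i\<in>I. (\<Sum>j\<in>J - {l}. b i j * x j) = 0"
      using insert.IH[of "J - {l}" b] insert.prems(1) by auto
    \<comment> \<open>Back substitution: the value of the unknown \<open>l\<close> that solves
      equation \<open>k\<close>.\<close>
    define y where "y = - (\<Sum>j\<in>J - {l}. a k j * x j) * inverse (a k l)"
    have "(\<Sum>j\<in>A. a k j * x j) \<in> L" if "finite A" "A \<subseteq> J - {l}" for A
      using that
    proof (induction A rule: finite_induct)
      case (insert c A)
      then show ?case using x(1) insert.prems L(4) \<open>\<And>i j. i \<in> insert k I \<Longrightarrow> j \<in> J \<Longrightarrow> a i j \<in> L\<close>
        by (auto intro!: La)
    qed (use L in auto)
    then have "(\<Sum>j\<in>J - {l}. a k j * x j) \<in> L" using insert.prems(1) by simp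
    then have yL: "y \<in> L"
      unfolding y_def using L insert.prems(3) l Lm by auto
    let ?z = "x(l := y)"
    have split: "(\<Sum>j\<in>J. a i j * ?z j) = a i l * y + (\<Sum>j\<in>J - {l}. a i j * x j)" for i
      using l(1) insert.prems(1) by (subst sum.remove[of _ l]) (auto intro!: sum.cong)
    have "(\<Sum>j\<in>J. a i j * ?z j) = 0" if "i \<in> insert k I" for i
    proof (cases "i = k")
      case True
      then show ?thesis unfolding split unfolding y_def using l(2) by simp
    next
      case False
      then have "0 = (\<Sum>j\<in>J - {l}. b i j * x j)" using x(3) that by simp
      also have "\<dots> = (\<Sum>j\<in>J - {l}. a i j * x j - a i l * inverse (a k l) * (a k j * x j))"
        unfolding b_def by (intro sum.cong) (auto simp: algebra_simps)
      also have "\<dots> = (\<Sum>j\<in>J - {l}. a i j * x j) + a i l * y"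
        unfolding y_def by (simp add: sum_subtractf sum_distrib_left[symmetric])
      finally show ?thesis unfolding split by (simp add: add.commute)
    qed
    then show ?thesis using x(1,2) yL by (intro exI[of _ ?z]) auto
  qed
qed

text \<open>A relation is shortened: its value at \<open>z * y\<close> minus \<open>t z\<close>
  times its value at \<open>y\<close> no longer involves \<open>t\<close>, while each other
  \<open>c s\<close> is multiplied by \<open>s z - t z\<close>. Membership in
  \<open>extensional K\<close> guarantees that distinct functions differ at some \<open>z\<close> in
  \<open>K\<close>.\<close>

lemma dedekind_independence:
  fixes c :: "('a::field \<Rightarrow> 'a) \<Rightarrow> 'a"
  assumes "finite S" and "1 \<in> K" and mult: "\<And>x y. x \<in> K \<Longrightarrow> y \<in> K \<Longrightarrow> x * y \<in> K"
    and "\<forall>s\<in>S. \<forall>x\<in>K. \<forall>y\<in>K. s (x * y) = s x * s y"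
    and "\<forall>s\<in>S. s 1 = 1"
    and "S \<subseteq> extensional K"
    and "\<forall>y\<in>K. (\<Sum>s\<in>S. c s * s y) = 0"
  shows "\<forall>s\<in>S. c s = 0"
  using assms(1,4-)
proof (induction S arbitrary: c rule: finite_induct)
  case empty
  show ?case by blast
next
  case (insert t S)
  have eq: "c t * t y + (\<Sum>s\<in>S. c s * s y) = 0" if "y \<in> K" for y
    using bspec[OF insert.prems(4) that] insert.hyps by simp
  have mult_S: "u (x * y) = u x * u y" if "u \<in> insert t S" "x \<in> K" "y \<in> K" for u x y
    using insert.prems(1) that by blast
  have c0: "c s = 0" if s: "s \<in> S" for s
  proof -
    have "s \<noteq> t" using s insert.hyps by auto
    then have "\<exists>z\<in>K. s z \<noteq> t z"
      using extensionalityI[of s K t] insert.prems(3) s by auto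
    then obtain z where z: "z \<in> K" "s z \<noteq> t z" by auto
    have "(\<Sum>s\<in>S. c s * (s z - t z) * s y) = 0" if y: "y \<in> K" for y
    proof -
      have "(\<Sum>s\<in>S. c s * (s z - t z) * s y) = (\<Sum>s\<in>S. c s * s (z * y)) - t z * (\<Sum>s\<in>S. c s * s y)"
        unfolding sum_distrib_left sum_subtractf[symmetric]
      proof (rule sum.cong)
        fix u assume "u \<in> S"
        then show "c u * (u z - t z) * u y = c u * u (z * y) - t z * (c u * u y)"
          using mult_S[of u z y] z(1) y by (simp add: algebra_simps)
      qed simp
      also have "\<dots> = - c t * t (z * y) + t z * (c t * t y)"
      proof -
        have "(\<Sum>s\<in>S. c s * s (z * y)) = - (c t * t (z * y))"
          using eq[OF mult[OF z(1) y]] by (simp add: eq_neg_iff_add_eq_0 add.commute)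
        moreover have "(\<Sum>s\<in>S. c s * s y) = - (c t * t y)"
          using eq[OF y] by (simp add: eq_neg_iff_add_eq_0 add.commute)
        ultimately show ?thesis by simp
      qed
      also have "\<dots> = 0" using mult_S[of t z y] z(1) y by simp
      finally show ?thesis .
    qed
    then have "\<forall>y\<in>K. (\<Sum>s\<in>S. c s * (s z - t z) * s y) = 0" by blast
    then have "c s * (s z - t z) = 0"
      using insert.IH[of "\<lambda>s. c s * (s z - t z)"] insert.prems(1-3) s by blast
    then show ?thesis using z(2) by simp
  qed
  have "(\<Sum>s\<in>S. c s * s 1) = 0" using c0 by (intro sum.neutral) auto
  moreover have "t 1 = 1" using insert.prems(2) by blast
  ultimately have ct: "c t = 0" using eq[OF assms(2)] by simp
  then show ?case using c0 by blast
qed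

text \<open>The extensional functions form a set with exactly one representative of each
  automorphism, so that it can be counted.\<close>

definition galois_group :: "'a::field_char_0 set \<Rightarrow> ('a \<Rightarrow> 'a) set" where
  "galois_group K = automorphisms_over_Q K \<inter> extensional K"

section \<open>The field \<open>K\<close> and its automorphisms\<close>

locale galois_field =
  fixes K :: "'a::field_char_0 set"
  assumes galois: "galois_number_field K"
begin

abbreviation "\<Gamma> \<equiv> galois_group K"

lemma subfield_K: "subfield K ring_of_type_algebra"
  using galois by (simp add: galois_number_field_def number_field_def)

lemma K_closed:
  shows K_0: "0 \<in> K" and K_1: "1 \<in> K"
    and K_add: "x \<in> K \<Longrightarrow> y \<in> K \<Longrightarrow> x + y \<in> K"
    and K_mult: "x \<in> K \<Longrightarrow> y \<in> K \<Longrightarrow> x * y \<in> K"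
    and K_minus: "x \<in> K \<Longrightarrow> - x \<in> K"
proof -
  note K = subringE[OF subfieldE(1)[OF subfield_K]]
  interpret R: ring "ring_of_type_algebra :: 'a ring" by (rule ring_from_type_algebra)
  have m: "\<ominus>\<^bsub>ring_of_type_algebra\<^esub> x = - x" for x :: 'a
    by (rule R.minus_equality) (auto simp: ring_of_type_algebra_def)
  show "0 \<in> K" "1 \<in> K" "x \<in> K \<Longrightarrow> y \<in> K \<Longrightarrow> x + y \<in> K"
    "x \<in> K \<Longrightarrow> y \<in> K \<Longrightarrow> x * y \<in> K" "x \<in> K \<Longrightarrow> - x \<in> K"
    using K(2,3,5,6,7) m by (auto simp: ring_of_type_algebra_def)
qed

lemma K_diff: "x \<in> K \<Longrightarrow> y \<in> K \<Longrightarrow> x - y \<in> K"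
  using K_add[OF _ K_minus] by fastforce

lemma K_sum: "(\<And>x. x \<in> A \<Longrightarrow> f x \<in> K) \<Longrightarrow> sum f A \<in> K"
  by (induction A rule: infinite_finite_induct) (auto intro: K_add K_0)

lemma K_prod: "(\<And>x. x \<in> A \<Longrightarrow> f x \<in> K) \<Longrightarrow> prod f A \<in> K"
  by (induction A rule: infinite_finite_induct) (auto intro: K_mult K_1)

lemma K_inverse:
  assumes "x \<in> K"
  shows "inverse x \<in> K"
proof (cases "x = 0")
  case False
  interpret R: field "ring_of_type_algebra :: 'a ring" by (rule field_from_type_algebra)
  have "inv\<^bsub>ring_of_type_algebra\<^esub> x \<in> K"
    using R.subfield_m_inv(1)[OF subfield_K, of x] assms False by (auto simp: ring_of_type_algebra_def)
  moreover have "inv\<^bsub>ring_of_type_algebra\<^esub> x = inverse x"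
    using False by (intro R.comm_inv_char) (auto simp: ring_of_type_algebra_def)
  ultimately show ?thesis by simp
qed (use assms in simp)

lemma subspace_K: "rat_vs.subspace K"
  using galois rat_vs.subspace_span unfolding galois_number_field_def number_field_def by metis

lemma K_of_rat: "of_rat c \<in> K"
  using rat_vs.subspace_scale[OF subspace_K K_1, of c] by simp

lemma gal:
  assumes "s \<in> \<Gamma>"
  shows gal_bij: "bij_betw s K K" and gal_closed: "x \<in> K \<Longrightarrow> s x \<in> K"
    and gal_add: "x \<in> K \<Longrightarrow> y \<in> K \<Longrightarrow> s (x + y) = s x + s y"
    and gal_mult: "x \<in> K \<Longrightarrow> y \<in> K \<Longrightarrow> s (x * y) = s x * s y"
    and gal_1: "s 1 = 1" and gal_rat: "x \<in> \<rat> \<Longrightarrow> s x = x"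
    and gal_ext: "s \<in> extensional K"
  using assms
  by (auto simp: galois_group_def automorphisms_over_Q_def ring_iso_def ring_hom_def field_on_def
      ring_of_type_algebra_def)

lemma gal_0: "s \<in> \<Gamma> \<Longrightarrow> s 0 = 0" by (rule gal_rat) auto

lemma gal_diff:
  assumes "s \<in> \<Gamma>" "x \<in> K" "y \<in> K"
  shows "s (x - y) = s x - s y"
  using gal_add[OF assms(1) K_diff[OF assms(2,3)] assms(3)] by simp

lemma gal_minus: "s \<in> \<Gamma> \<Longrightarrow> x \<in> K \<Longrightarrow> s (- x) = - s x"
  using gal_diff[of s 0 x] K_0 gal_0 by simp

lemma gal_sum:
  assumes "s \<in> \<Gamma>" "\<And>x. x \<in> A \<Longrightarrow> f x \<in> K"
  shows "s (sum f A) = (\<Sum>x\<in>A. s (f x))"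
  using assms(2)
  by (induction A rule: infinite_finite_induct) (simp_all add: gal_0 assms(1) gal_add K_sum)

lemma gal_eq_0_iff: "s \<in> \<Gamma> \<Longrightarrow> x \<in> K \<Longrightarrow> s x = 0 \<longleftrightarrow> x = 0"
  using gal_bij[of s] gal_0[of s] K_0 unfolding bij_betw_def inj_on_def by metis

lemma galI:
  assumes "s \<in> extensional K" "bij_betw s K K" "s 1 = 1"
    "\<And>x y. x \<in> K \<Longrightarrow> y \<in> K \<Longrightarrow> s (x + y) = s x + s y"
    "\<And>x y. x \<in> K \<Longrightarrow> y \<in> K \<Longrightarrow> s (x * y) = s x * s y"
    "\<And>x. x \<in> \<rat> \<Longrightarrow> s x = x"
  shows "s \<in> \<Gamma>"
  using assms bij_betwE[OF assms(2)]
  by (auto simp: galois_group_def automorphisms_over_Q_def ring_iso_def ring_hom_def field_on_def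
      ring_of_type_algebra_def)

lemma Rats_K: "x \<in> \<rat> \<Longrightarrow> x \<in> K"
  using K_of_rat by (auto elim: Rats_cases)

text \<open>Restricting any automorphism to \<open>K\<close> yields a member of
  \<open>\<Gamma>\<close> with the same values on \<open>K\<close>, so invariance under
  \<open>\<Gamma>\<close> is invariance under all representatives.\<close>

lemma fixed_Rats:
  assumes "x \<in> K" "\<And>s. s \<in> \<Gamma> \<Longrightarrow> s x = x"
  shows "x \<in> \<rat>"
proof -
  have "s x = x" if "s \<in> automorphisms_over_Q K" for s
  proof -
    have b: "bij_betw (restrict s K) K K"
      using that by (simp add: automorphisms_over_Q_def ring_iso_def field_on_def)
    have "restrict s K \<in> \<Gamma>"
      using that b by (intro galI)
        (auto simp: automorphisms_over_Q_def ring_iso_def ring_hom_def field_on_def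
          ring_of_type_algebra_def K_1 K_add K_mult Rats_K)
    then show ?thesis using assms by force
  qed
  then show ?thesis using galois assms(1) by (auto simp: galois_number_field_def)
qed

lemma subgroup_galois_group: "subgroup \<Gamma> (BijGroup K)"
proof -
  interpret B: group "BijGroup K" by (rule group_BijGroup)
  have sub: "\<Gamma> \<subseteq> Bij K" by (auto simp: Bij_def gal_bij gal_ext)
  show ?thesis
  proof (rule B.subgroupI)
    show "\<Gamma> \<subseteq> carrier (BijGroup K)" using sub by (simp add: BijGroup_def)
    have "(\<lambda>x\<in>K. x) \<in> \<Gamma>"
      by (rule galI) (auto simp: K_1 K_add K_mult Rats_K bij_betw_def inj_on_def)
    then show "\<Gamma> \<noteq> {}" by auto
    fix s assume s: "s \<in> \<Gamma>"
    let ?i = "restrict (inv_into K s) K"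
    have ib: "?i \<in> Bij K" using s sub restrict_inv_into_Bij by blast
    have i: "?i x \<in> K \<and> s (?i x) = x" if "x \<in> K" for x
      using gal_bij[OF s] that by (simp add: bij_betw_def f_inv_into_f inv_into_into)
    have u: "y = ?i x" if "x \<in> K" "y \<in> K" "s y = x" for x y
      using gal_bij[OF s] that i[OF that(1)] by (auto simp: bij_betw_def inj_on_def)
    have "?i \<in> \<Gamma>"
    proof (rule galI)
      show "?i \<in> extensional K" "bij_betw ?i K K" using ib by (auto simp: Bij_def)
      show "?i 1 = 1" using u[of 1 1] gal_1[OF s] K_1 by simp
      show "?i (x + y) = ?i x + ?i y" if "x \<in> K" "y \<in> K" for x y
        using u[of "x + y" "?i x + ?i y"] that i gal_add[OF s] K_add by metis
      show "?i (x * y) = ?i x * ?i y" if "x \<in> K" "y \<in> K" for x y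
        using u[of "x * y" "?i x * ?i y"] that i gal_mult[OF s] K_mult by metis
      show "?i x = x" if "x \<in> \<rat>" for x
        using u[of x x] that Rats_K gal_rat[OF s] by metis
    qed
    then show "inv\<^bsub>BijGroup K\<^esub> s \<in> \<Gamma>" using inv_BijGroup[of s K] s sub by auto
  next
    fix s t assume st: "s \<in> \<Gamma>" "t \<in> \<Gamma>"
    have "compose K s t \<in> \<Gamma>"
    proof (rule galI)
      show "compose K s t \<in> extensional K" by (rule compose_extensional)
      show "bij_betw (compose K s t) K K" using st gal_bij bij_betw_compose by blast
    qed (use st in \<open>auto simp: compose_def K_1 K_add K_mult gal_1 gal_add gal_mult gal_closed
          gal_rat Rats_K\<close>)
    then show "s \<otimes>\<^bsub>BijGroup K\<^esub> t \<in> \<Gamma>" using st sub by (auto simp: BijGroup_def)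
  qed
qed

definition Gal :: "('a \<Rightarrow> 'a) monoid" where "Gal = BijGroup K\<lparr>carrier := \<Gamma>\<rparr>"

lemma group_Gal: "group Gal"
  unfolding Gal_def using subgroup.subgroup_is_group[OF subgroup_galois_group group_BijGroup] .

lemma carrier_Gal: "carrier Gal = \<Gamma>" by (simp add: Gal_def)

lemma mult_Gal: "s \<in> \<Gamma> \<Longrightarrow> t \<in> \<Gamma> \<Longrightarrow> s \<otimes>\<^bsub>Gal\<^esub> t = compose K s t"
  by (simp add: Gal_def BijGroup_def Bij_def gal_ext gal_bij)

lemma compose_gal: "s \<in> \<Gamma> \<Longrightarrow> t \<in> \<Gamma> \<Longrightarrow> compose K s t \<in> \<Gamma>"
  using group.is_monoid[OF group_Gal] monoid.m_closed[of Gal s t] by (simp add: carrier_Gal mult_Gal)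

lemma one_Gal: "\<one>\<^bsub>Gal\<^esub> = (\<lambda>x\<in>K. x)" by (simp add: Gal_def BijGroup_def)

lemma id_gal: "(\<lambda>x\<in>K. x) \<in> \<Gamma>"
  using group.is_monoid[OF group_Gal] monoid.one_closed[of Gal] by (simp add: carrier_Gal one_Gal)

text \<open>Left translation permutes a group; this makes sums and products over all conjugates
  invariant.\<close>

lemma bij_compose_gal:
  assumes "t \<in> \<Gamma>"
  shows "bij_betw (compose K t) \<Gamma> \<Gamma>"
proof -
  interpret G: group Gal by (rule group_Gal)
  have "bij_betw (\<lambda>s. t \<otimes>\<^bsub>Gal\<^esub> s) \<Gamma> \<Gamma>"
    using G.inj_on_cmult[of t] G.surj_const_mult[of t] assms by (simp add: bij_betw_def carrier_Gal)
  then show ?thesis using assms by (simp add: mult_Gal cong: bij_betw_cong)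
qed

section \<open>Traces and Artin's theorem\<close>

lemma sum_gal_fixed:
  assumes "t \<in> \<Gamma>" "x \<in> K"
  shows "t (\<Sum>s\<in>\<Gamma>. s x) = (\<Sum>s\<in>\<Gamma>. s x)"
proof -
  have "t (\<Sum>s\<in>\<Gamma>. s x) = (\<Sum>s\<in>\<Gamma>. compose K t s x)"
    using assms by (subst gal_sum) (auto simp: gal_closed compose_def)
  also have "\<dots> = (\<Sum>s\<in>\<Gamma>. s x)"
    using sum.reindex_bij_betw[OF bij_compose_gal[OF assms(1)], of "\<lambda>s. s x"] by simp
  finally show ?thesis .
qed

lemma trace_Rats:
  assumes "x \<in> K"
  shows "(\<Sum>s\<in>\<Gamma>. s x) \<in> \<rat>"
  by (rule fixed_Rats) (use assms in \<open>auto intro: K_sum gal_closed sum_gal_fixed\<close>)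

lemma basis:
  obtains B where "finite B" "B \<subseteq> K" "rat_vs.independent B" "rat_vs.span B = K"
    "card B = degree_over_Q K"
proof -
  obtain B where B: "B \<subseteq> K" "rat_vs.independent B" "K \<subseteq> rat_vs.span B" "card B = rat_vs.dim K"
    using rat_vs.basis_exists by blast
  obtain C where C: "finite C" "rat_vs.span C = K"
    using galois by (auto simp: galois_number_field_def number_field_def)
  have "finite B" using rat_vs.independent_span_bound[OF C(1) B(2)] B(1) C(2) by simp
  moreover have "rat_vs.span B = K" using rat_vs.span_subspace[OF B(1,3) subspace_K] .
  ultimately show thesis using that B by (simp add: degree_over_Q_def)
qed

text \<open>More automorphisms than basis elements would satisfy a linear relation on the basis,
  hence on all of \<open>K\<close>, against Dedekind independence. Finite subsets are considered
  because the finiteness of \<open>\<Gamma>\<close> is a consequence.\<close>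

lemma card_gal_subset_le:
  assumes "finite S" "S \<subseteq> \<Gamma>"
  shows "card S \<le> degree_over_Q K"
proof (rule ccontr)
  assume less: "\<not> card S \<le> degree_over_Q K"
  obtain B where B: "finite B" "B \<subseteq> K" "rat_vs.span B = K" "card B = degree_over_Q K"
    by (rule basis)
  \<comment> \<open>There is one equation for each basis element and one unknown for each
    automorphism.\<close>
  have "\<exists>x. (\<forall>s\<in>S. x s \<in> UNIV) \<and> (\<exists>s\<in>S. x s \<noteq> 0) \<and> (\<forall>b\<in>B. (\<Sum>s\<in>S. s b * x s) = 0)"
    by (rule homogeneous_system_nontrivial_solution) (use B less assms in auto)
  then obtain x where x: "\<exists>s\<in>S. x s \<noteq> 0" "\<And>b. b \<in> B \<Longrightarrow> (\<Sum>s\<in>S. s b * x s) = 0" by auto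
  have "rat_vs.subspace {y \<in> K. (\<Sum>s\<in>S. s y * x s) = 0}"
  proof (rule rat_vs.subspaceI)
    show "0 \<in> {y \<in> K. (\<Sum>s\<in>S. s y * x s) = 0}"
      using assms(2) gal_0 K_0 by (auto intro!: sum.neutral)
    show "y + z \<in> {y \<in> K. (\<Sum>s\<in>S. s y * x s) = 0}"
      if "y \<in> {y \<in> K. (\<Sum>s\<in>S. s y * x s) = 0}" "z \<in> {y \<in> K. (\<Sum>s\<in>S. s y * x s) = 0}" for y z
    proof -
      have "(\<Sum>s\<in>S. s (y + z) * x s) = (\<Sum>s\<in>S. s y * x s) + (\<Sum>s\<in>S. s z * x s)"
        unfolding sum.distrib[symmetric]
      proof (rule sum.cong)
        fix s assume "s \<in> S"
        then show "s (y + z) * x s = s y * x s + s z * x s"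
          using gal_add[of s y z] assms(2) that by (auto simp: distrib_right)
      qed simp
      then show ?thesis using that K_add by simp
    qed
    show "of_rat c * y \<in> {y \<in> K. (\<Sum>s\<in>S. s y * x s) = 0}"
      if "y \<in> {y \<in> K. (\<Sum>s\<in>S. s y * x s) = 0}" for c y
    proof -
      have "(\<Sum>s\<in>S. s (of_rat c * y) * x s) = of_rat c * (\<Sum>s\<in>S. s y * x s)"
        unfolding sum_distrib_left
      proof (rule sum.cong)
        fix s assume "s \<in> S"
        then have "s \<in> \<Gamma>" using assms(2) by auto
        then show "s (of_rat c * y) * x s = of_rat c * (s y * x s)"
          using gal_mult[OF _ K_of_rat[of c], of s y] gal_rat[of s "of_rat c"] that by simp
      qed simp
      then show ?thesis using that K_mult K_of_rat by simp
    qed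
  qed
  then have "rat_vs.span B \<subseteq> {y \<in> K. (\<Sum>s\<in>S. s y * x s) = 0}"
    using x(2) B(2) by (intro rat_vs.span_minimal) auto
  then have dep: "(\<Sum>s\<in>S. x s * s y) = 0" if "y \<in> K" for y
    using that B(3) by (auto simp: mult.commute)
  have "\<forall>s\<in>S. x s = 0"
  proof (rule dedekind_independence[OF assms(1) K_1 K_mult])
    show "\<forall>s\<in>S. \<forall>y\<in>K. \<forall>z\<in>K. s (y * z) = s y * s z" using gal_mult assms(2) by blast
    show "\<forall>s\<in>S. s 1 = 1" using gal_1 assms(2) by blast
    show "S \<subseteq> extensional K" using gal_ext assms(2) by blast
    show "\<forall>y\<in>K. (\<Sum>s\<in>S. x s * s y) = 0" using dep by blast
  qed
  then show False using x(1) by blast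
qed

lemma finite_gal: "finite \<Gamma>"
  using finite_if_finite_subsets_card_bdd[of \<Gamma> "degree_over_Q K"] card_gal_subset_le by auto

lemma card_gal_pos: "card \<Gamma> > 0"
  using finite_gal id_gal by (auto simp: card_gt_0_iff)

lemma trace_1: "(\<Sum>s\<in>\<Gamma>. s 1) = of_nat (card \<Gamma>)"
proof -
  have "(\<Sum>s\<in>\<Gamma>. s 1) = (\<Sum>s\<in>\<Gamma>. 1)" using gal_1 by (intro sum.cong) auto
  then show ?thesis by simp
qed

text \<open>If the basis were larger than \<open>\<Gamma>\<close>, the system with one equation for
  each automorphism would have a non-trivial solution \<open>y\<close> in \<open>K\<close>. Applying
  all automorphisms and adding up gives a rational relation between basis elements whose
  coefficients are the traces of the \<open>y b\<close>; all of these must vanish, although the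
  trace of 1 does not.\<close>

theorem card_galois_group: "card \<Gamma> = degree_over_Q K"
proof (rule antisym[OF card_gal_subset_le[OF finite_gal subset_refl]], rule ccontr)
  assume "\<not> degree_over_Q K \<le> card \<Gamma>"
  moreover obtain B where B: "finite B" "B \<subseteq> K" "rat_vs.independent B" "card B = degree_over_Q K"
    by (rule basis)
  ultimately have "\<exists>x. (\<forall>b\<in>B. x b \<in> K) \<and> (\<exists>b\<in>B. x b \<noteq> 0) \<and> (\<forall>s\<in>\<Gamma>. (\<Sum>b\<in>B. s b * x b) = 0)"
    by (intro homogeneous_system_nontrivial_solution)
      (use K_closed K_diff K_inverse finite_gal gal_closed in auto)
  then obtain x c where x: "\<And>b. b \<in> B \<Longrightarrow> x b \<in> K" "c \<in> B" "x c \<noteq> 0"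
    "\<And>s. s \<in> \<Gamma> \<Longrightarrow> (\<Sum>b\<in>B. s b * x b) = 0" by blast
  \<comment> \<open>The solution is scaled so that its entry at \<open>c\<close> is 1, whose trace
    is known.\<close>
  define y where "y b = x b * inverse (x c)" for b
  have yK: "y b \<in> K" if "b \<in> B" for b
    using that x(1,2) K_mult K_inverse by (simp add: y_def)
  have y: "(\<Sum>b\<in>B. s b * y b) = 0" if "s \<in> \<Gamma>" for s
    using x(4)[OF that] by (simp add: y_def mult.assoc[symmetric] flip: sum_distrib_right)
  interpret G: group Gal by (rule group_Gal)
  \<comment> \<open>With \<open>s\<close> the inverse of \<open>t\<close>, applying \<open>t\<close>
    to the equation for \<open>s\<close> turns \<open>s b\<close> into \<open>b\<close>.\<close>
  have "(\<Sum>b\<in>B. b * t (y b)) = 0" if t: "t \<in> \<Gamma>" for t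
  proof -
    define s where "s = inv\<^bsub>Gal\<^esub> t"
    have s: "s \<in> \<Gamma>" using G.inv_closed t by (simp add: s_def carrier_Gal)
    have "compose K t s = (\<lambda>x\<in>K. x)"
      using G.r_inv[of t] t s by (simp add: carrier_Gal one_Gal s_def[symmetric] mult_Gal)
    then have ts: "t (s b) = b" if "b \<in> B" for b
      using that B(2) by (metis compose_eq restrict_apply' subsetD)
    have "0 = t (\<Sum>b\<in>B. s b * y b)" using y[OF s] gal_0[OF t] by simp
    also have "\<dots> = (\<Sum>b\<in>B. t (s b * y b))"
    proof (rule gal_sum[OF t])
      show "s b * y b \<in> K" if "b \<in> B" for b
        using K_mult[OF gal_closed[OF s, of b] yK[OF that]] B(2) that by auto
    qed
    also have "\<dots> = (\<Sum>b\<in>B. b * t (y b))"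
    proof (rule sum.cong)
      fix b assume b: "b \<in> B"
      show "t (s b * y b) = b * t (y b)"
        using gal_mult[OF t gal_closed[OF s, of b] yK[OF b]] B(2) b ts[OF b] by auto
    qed simp
    finally show ?thesis by simp
  qed
  then have "0 = (\<Sum>t\<in>\<Gamma>. \<Sum>b\<in>B. b * t (y b))" by simp
  also have "\<dots> = (\<Sum>b\<in>B. (\<Sum>t\<in>\<Gamma>. t (y b)) * b)"
    by (subst sum.swap) (simp add: sum_distrib_left mult.commute)
  finally have eq: "0 = (\<Sum>b\<in>B. (\<Sum>t\<in>\<Gamma>. t (y b)) * b)" .
  have "\<forall>b\<in>B. \<exists>q. (\<Sum>t\<in>\<Gamma>. t (y b)) = of_rat q"
    using trace_Rats[OF yK] unfolding Rats_def by blast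
  then obtain r where r: "\<And>b. b \<in> B \<Longrightarrow> (\<Sum>t\<in>\<Gamma>. t (y b)) = of_rat (r b)"
    unfolding bchoice_iff by blast
  have "r c = 0"
    using rat_vs.independentD[OF B(3,1) subset_refl, of r c] eq r x(2) by simp
  then have "(\<Sum>t\<in>\<Gamma>. t (y c)) = 0" using r[OF x(2)] by simp
  moreover have "y c = 1" using x(3) by (simp add: y_def)
  ultimately show False using trace_1 card_gal_pos by simp
qed

end

section \<open>Norms of integral ideals\<close>

context galois_field
begin

section \<open>Conjugates of polynomials over \<open>K\<close>\<close>

abbreviation "\<O> \<equiv> ring_of_integers K"

abbreviation coeffs_in_K :: "'a poly \<Rightarrow> bool" where
  "coeffs_in_K f \<equiv> \<forall>i. coeff f i \<in> K"

lemma coeffs_in_K_mult: "coeffs_in_K f \<Longrightarrow> coeffs_in_K g \<Longrightarrow> coeffs_in_K (f * g)"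
  by (auto simp: coeff_mult intro!: K_sum K_mult)

lemma coeffs_in_K_prod: "(\<And>x. x \<in> A \<Longrightarrow> coeffs_in_K (f x)) \<Longrightarrow> coeffs_in_K (prod f A)"
proof (induction A rule: infinite_finite_induct)
  case (insert x A)
  then show ?case using coeffs_in_K_mult[of "f x" "prod f A"] by simp
qed (auto simp: K_0 K_1)

lemma coeff_map_gal: "s \<in> \<Gamma> \<Longrightarrow> coeff (map_poly s f) i = s (coeff f i)"
  by (simp add: coeff_map_poly gal_0)

lemma coeffs_in_K_map_gal: "s \<in> \<Gamma> \<Longrightarrow> coeffs_in_K f \<Longrightarrow> coeffs_in_K (map_poly s f)"
  by (simp add: coeff_map_gal gal_closed)

lemma map_gal_mult:
  assumes "s \<in> \<Gamma>" "coeffs_in_K f" "coeffs_in_K g"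
  shows "map_poly s (f * g) = map_poly s f * map_poly s g"
proof (rule poly_eqI)
  fix n
  have "s (\<Sum>i\<le>n. coeff f i * coeff g (n - i)) = (\<Sum>i\<le>n. s (coeff f i * coeff g (n - i)))"
    using assms by (intro gal_sum) (auto intro: K_mult)
  then show "coeff (map_poly s (f * g)) n = coeff (map_poly s f * map_poly s g) n"
    using assms by (simp add: coeff_map_gal coeff_mult gal_mult)
qed

lemma map_gal_prod:
  assumes "s \<in> \<Gamma>" "\<And>x. x \<in> A \<Longrightarrow> coeffs_in_K (f x)"
  shows "map_poly s (prod f A) = (\<Prod>x\<in>A. map_poly s (f x))"
  using assms(2)
proof (induction A rule: infinite_finite_induct)
  case (insert x A)
  have "map_poly s (f x * prod f A) = map_poly s (f x) * map_poly s (prod f A)"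
    by (rule map_gal_mult) (use assms(1) insert.prems in \<open>auto intro!: coeffs_in_K_prod[rule_format]\<close>)
  then show ?case using insert by simp
qed (use gal_1[OF assms(1)] in \<open>auto simp: map_poly_1\<close>)

text \<open>An automorphism merely permutes the conjugate factors, so it fixes the coefficients of
  their product.\<close>

lemma norm_poly_Rats:
  assumes "coeffs_in_K f"
  shows "coeff (\<Prod>s\<in>\<Gamma>. map_poly s f) i \<in> \<rat>"
proof (rule fixed_Rats)
  show "coeff (\<Prod>s\<in>\<Gamma>. map_poly s f) i \<in> K"
    using coeffs_in_K_prod[of \<Gamma> "\<lambda>s. map_poly s f"] coeffs_in_K_map_gal[OF _ assms] by blast
  fix t assume t: "t \<in> \<Gamma>"
  have comp: "map_poly t (map_poly s f) = map_poly (compose K t s) f" if s: "s \<in> \<Gamma>" for s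
    by (rule poly_eqI) (use assms in \<open>simp add: coeff_map_gal s t compose_gal compose_eq\<close>)
  have "map_poly t (\<Prod>s\<in>\<Gamma>. map_poly s f) = (\<Prod>s\<in>\<Gamma>. map_poly t (map_poly s f))"
    using coeffs_in_K_map_gal[OF _ assms] t by (intro map_gal_prod) blast+
  also have "\<dots> = (\<Prod>s\<in>\<Gamma>. map_poly (compose K t s) f)" using comp by simp
  also have "\<dots> = (\<Prod>s\<in>\<Gamma>. map_poly s f)"
    using prod.reindex_bij_betw[OF bij_compose_gal[OF t], of "\<lambda>s. map_poly s f"] by simp
  finally show "t (coeff (\<Prod>s\<in>\<Gamma>. map_poly s f) i) = coeff (\<Prod>s\<in>\<Gamma>. map_poly s f) i"
    using coeff_map_gal[OF t] by metis
qed

text \<open>The product of the conjugates of the polynomial \<open>X - x\<close> is non-zero with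
  rational coefficients, and its factor for the identity vanishes at \<open>x\<close>.\<close>

lemma algebraic_K:
  assumes "x \<in> K"
  shows "algebraic x"
proof -
  let ?f = "[:- x, 1:]"
  let ?F = "\<Prod>s\<in>\<Gamma>. map_poly s ?f"
  have K: "coeffs_in_K ?f" using assms by (auto simp: coeff_pCons K_0 K_1 K_minus split: nat.split)
  have "map_poly s ?f \<noteq> 0" if "s \<in> \<Gamma>" for s
    using coeff_map_gal[OF that, of ?f 1] gal_1[OF that] by auto
  then have "?F \<noteq> 0" using finite_gal by auto
  moreover have "poly ?F x = 0"
  proof -
    have "map_poly (\<lambda>x\<in>K. x) ?f = ?f"
      by (rule poly_eqI) (use K in \<open>simp add: coeff_map_gal[OF id_gal]\<close>)
    then show ?thesis
      using finite_gal id_gal by (auto simp: poly_prod intro!: prod_zero bexI[of _ "\<lambda>x\<in>K. x"])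
  qed
  ultimately show ?thesis
    using norm_poly_Rats[OF K] by (auto simp: algebraic_altdef)
qed

text \<open>The leading coefficient of an integer polynomial vanishing at \<open>x\<close> serves as
  \<open>m\<close>.\<close>

lemma integral_multiple:
  assumes "x \<in> K"
  obtains m :: int where "m \<noteq> 0" "algebraic_int (of_int m * x)"
proof -
  obtain p where p: "\<And>i. coeff p i \<in> \<int>" "p \<noteq> 0" "poly p x = 0"
    using algebraic_K[OF assms] by (auto simp: algebraic_def)
  have "algebraic_int (lead_coeff p * x)"
    by (rule algebraic_int_lead_coeff_mult_root) (use p int_imp_algebraic_int in auto)
  moreover obtain m where "lead_coeff p = of_int m" using p(1) by (meson Ints_cases)
  moreover have "lead_coeff p \<noteq> 0" using p(2) by simp
  ultimately show thesis using that[of m] by fastforce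
qed

lemma gal_algebraic_int:
  assumes "s \<in> \<Gamma>" "x \<in> K" "algebraic_int x"
  shows "algebraic_int (s x)"
proof -
  obtain p :: "int poly" where p: "poly (map_poly of_int p) x = 0" "lead_coeff p = 1"
    using assms(3) algebraic_int_altdef_ipoly by blast
  have pow: "x ^ n \<in> K \<and> s (x ^ n) = s x ^ n" for n
    by (induction n) (use assms in \<open>auto simp: K_1 gal_1 K_mult gal_mult\<close>)
  have c: "of_int k \<in> K" "s (of_int k) = of_int k" for k :: int
    using K_of_rat[of "of_int k"] gal_rat[OF assms(1), of "of_int k"] by auto
  have "s (\<Sum>i\<le>degree p. of_int (coeff p i) * x ^ i) = (\<Sum>i\<le>degree p. s (of_int (coeff p i) * x ^ i))"
    by (rule gal_sum[OF assms(1)]) (use pow c K_mult in auto)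
  also have "\<dots> = (\<Sum>i\<le>degree p. of_int (coeff p i) * s x ^ i)"
    using pow c by (simp add: gal_mult[OF assms(1)])
  finally have "poly (map_poly of_int p) (s x) = 0"
    using p(1) gal_0[OF assms(1)] by (simp add: poly_altdef degree_map_poly coeff_map_poly)
  then show ?thesis using p(2) algebraic_int_altdef_ipoly by blast
qed

section \<open>Integers of \<open>K\<close> and their traces\<close>

lemma O_K: "x \<in> \<O> \<Longrightarrow> x \<in> K"
  and O_algebraic_int: "x \<in> \<O> \<Longrightarrow> algebraic_int x"
  and O_I: "x \<in> K \<Longrightarrow> algebraic_int x \<Longrightarrow> x \<in> \<O>"
  by (auto simp: ring_of_integers_def)

lemma O_closed:
  shows O_0: "0 \<in> \<O>" and O_1: "1 \<in> \<O>" and O_of_int: "of_int k \<in> \<O>"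
    and O_add: "x \<in> \<O> \<Longrightarrow> y \<in> \<O> \<Longrightarrow> x + y \<in> \<O>"
    and O_mult: "x \<in> \<O> \<Longrightarrow> y \<in> \<O> \<Longrightarrow> x * y \<in> \<O>"
    and O_minus: "x \<in> \<O> \<Longrightarrow> - x \<in> \<O>"
  using K_of_rat[of "of_int k"]
  by (auto simp: ring_of_integers_def K_closed algebraic_int_add algebraic_int_mult)

lemma gal_O: "s \<in> \<Gamma> \<Longrightarrow> x \<in> \<O> \<Longrightarrow> s x \<in> \<O>"
  using gal_algebraic_int gal_closed by (auto simp: ring_of_integers_def)

lemma rational_integer_trace:
  assumes "x \<in> \<O>"
  shows "(\<Sum>s\<in>\<Gamma>. s x) \<in> \<int>"
  using rational_algebraic_int_is_int[of "\<Sum>s\<in>\<Gamma>. s x"] trace_Rats[OF O_K[OF assms]]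
    algebraic_int_sum[of \<Gamma> "\<lambda>s. s x"] gal_O[OF _ assms] O_algebraic_int by blast

text \<open>The traces \<open>x \<mapsto> Tr (m\<^sub>b b x)\<close>, for \<open>b\<close> in a basis and \<open>m\<^sub>b b\<close> integral, embed \<open>N\<close> into a power of
  the integers.\<close>

theorem fin_gen_integral:
  assumes N: "int_mod.subspace N" "N \<subseteq> \<O>"
  shows "fin_gen N"
proof -
  define T where "T x = (\<Sum>s\<in>\<Gamma>. s x)" for x
  have T_add: "T (x + y) = T x + T y" if "x \<in> K" "y \<in> K" for x y
    unfolding T_def sum.distrib[symmetric] using gal_add that by (intro sum.cong) auto
  have T_diff: "T (x - y) = T x - T y" if "x \<in> K" "y \<in> K" for x y
    unfolding T_def sum_subtractf[symmetric] using gal_diff that by (intro sum.cong) auto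
  have T_scale: "T (q * x) = q * T x" if "x \<in> K" "q \<in> \<rat>" for x q
    unfolding T_def sum_distrib_left
  proof (rule sum.cong)
    fix s assume "s \<in> \<Gamma>"
    then show "s (q * x) = q * s x" using gal_mult[of s q x] gal_rat[of s q] Rats_K that by auto
  qed simp
  obtain B where B: "finite B" "B \<subseteq> K" "rat_vs.span B = K" by (rule basis)
  have "\<forall>b\<in>B. \<exists>m::int. m \<noteq> 0 \<and> algebraic_int (of_int m * b)"
    using integral_multiple B(2) by (metis subsetD)
  then obtain m :: "'a \<Rightarrow> int" where m: "\<And>b. b \<in> B \<Longrightarrow> m b \<noteq> 0 \<and> algebraic_int (of_int (m b) * b)"
    unfolding bchoice_iff by blast
  have mO: "of_int (m b) * b \<in> \<O>" if "b \<in> B" for b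
    using m[OF that] K_mult[OF O_K[OF O_of_int]] B(2) that by (intro O_I) auto
  have "\<forall>b\<in>B. \<forall>x\<in>N. \<exists>k::int. T (of_int (m b) * b * x) = of_int k"
    using rational_integer_trace O_mult[OF mO] N(2) unfolding T_def by (blast elim: Ints_cases)
  then obtain f :: "'a \<Rightarrow> 'a \<Rightarrow> int"
    where f: "\<And>b x. b \<in> B \<Longrightarrow> x \<in> N \<Longrightarrow> T (of_int (m b) * b * x) = of_int (f b x)"
    by metis
  show ?thesis
  proof (rule fin_gen_kernel[OF B(1) N(1)])
    show "f b (x - y) = f b x - f b y" if "b \<in> B" "x \<in> N" "y \<in> N" for b x y
    proof -
      have "(of_int (f b (x - y)) :: 'a) = T (of_int (m b) * b * x - of_int (m b) * b * y)"
        using f[of b "x - y"] that int_mod.subspace_diff[OF N(1)] by (simp add: right_diff_distrib)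
      also have "\<dots> = T (of_int (m b) * b * x) - T (of_int (m b) * b * y)"
        using that N(2) by (intro T_diff O_K O_mult[OF mO]) auto
      also have "\<dots> = of_int (f b x - f b y)" using f that by simp
      finally show ?thesis by (simp only: of_int_eq_iff)
    qed
  next
    fix x assume x: "x \<in> N" "\<And>b. b \<in> B \<Longrightarrow> f b x = 0"
    have xK: "x \<in> K" using x(1) N(2) O_K by auto
    have Tb: "T (b * x) = 0" if b: "b \<in> B" for b
    proof -
      have "of_int (m b) * T (b * x) = T (of_int (m b) * (b * x))"
        using T_scale[OF K_mult[OF _ xK], of b "of_int (m b)"] b B(2) by auto
      then show ?thesis using f[OF b x(1)] x(2)[OF b] m[OF b] by (simp add: mult.assoc)
    qed
    have "rat_vs.subspace {y \<in> K. T (y * x) = 0}"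
    proof (rule rat_vs.subspaceI)
      show "0 \<in> {y \<in> K. T (y * x) = 0}" using T_diff[OF K_0 K_0] K_0 by simp
      show "y + z \<in> {y \<in> K. T (y * x) = 0}"
        if "y \<in> {y \<in> K. T (y * x) = 0}" "z \<in> {y \<in> K. T (y * x) = 0}" for y z
        using that T_add[of "y * x" "z * x"] K_mult xK K_add by (simp add: distrib_right)
      show "of_rat c * y \<in> {y \<in> K. T (y * x) = 0}" if "y \<in> {y \<in> K. T (y * x) = 0}" for c y
        using that T_scale[of "y * x" "of_rat c"] K_mult K_of_rat xK by (simp add: mult.assoc)
    qed
    then have "rat_vs.span B \<subseteq> {y \<in> K. T (y * x) = 0}"
      using Tb B(2) by (intro rat_vs.span_minimal) auto
    \<comment> \<open>Non-degeneracy of the trace form: for \<open>x \<noteq> 0\<close> this would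
      make the trace of 1 vanish, which is the order of the Galois group.\<close>
    then have "T (inverse x * x) = 0" using B(3) K_inverse[OF xK] by auto
    then show "x = 0" using trace_1 card_gal_pos unfolding T_def by (cases "x = 0") auto
  qed
qed

section \<open>The content of the norm of a polynomial\<close>

lemma image_span_gal:
  assumes "s \<in> \<Gamma>" "C \<subseteq> K" "x \<in> int_mod.span C"
  shows "x \<in> K \<and> s x \<in> int_mod.span (s ` C)"
proof -
  have "int_mod.subspace {x \<in> K. s x \<in> int_mod.span (s ` C)}"
  proof (rule int_mod_subspaceI)
    show "0 \<in> {x \<in> K. s x \<in> int_mod.span (s ` C)}"
      using K_0 gal_0[OF assms(1)] int_mod.span_zero by simp
  qed (use K_add K_minus gal_add[OF assms(1)] gal_minus[OF assms(1)]
      int_mod.span_add int_mod.span_neg in auto)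
  moreover have "C \<subseteq> {x \<in> K. s x \<in> int_mod.span (s ` C)}"
    using assms(2) by (auto intro: int_mod.span_base)
  ultimately show ?thesis using int_mod.span_minimal assms(3) by blast
qed

text \<open>The rational integer \<open>d\<close> is the content of the norm of a polynomial whose coefficients
  generate \<open>J\<close>.\<close>

theorem norm_ideal_principal:
  assumes J: "int_mod.subspace J" "J \<subseteq> \<O>" "J \<noteq> {0}"
  obtains d :: 'a where "d \<in> K" "d \<noteq> 0"
    "\<And>x. (\<And>s. s \<in> \<Gamma> \<Longrightarrow> x s \<in> s ` J) \<Longrightarrow> (\<Prod>s\<in>\<Gamma>. x s) \<in> (\<lambda>a. d * a) ` \<O>"

    "\<And>M. int_mod.subspace M \<Longrightarrow>
      (\<And>f i. (\<And>s i. s \<in> \<Gamma> \<Longrightarrow> coeff (f s) i \<in> s ` J) \<Longrightarrow> coeff (\<Prod>s\<in>\<Gamma>. f s) i \<in> M) \<Longrightarrow> d \<in> M"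
proof -
  obtain B where B: "finite B" "int_mod.span B = J"
    using fin_gen_integral[OF J(1,2)] by (auto simp: fin_gen_def)
  obtain bs where bs: "set bs = B" using finite_list[OF B(1)] by auto
  \<comment> \<open>Any polynomial with the generators as coefficients will do, in whatever order;
    the coefficients beyond its degree only add 0 to the span.\<close>
  define f where "f = Poly bs"
  have range: "B \<subseteq> range (coeff f)" "range (coeff f) \<subseteq> insert 0 B"
    unfolding f_def bs[symmetric]
    by (auto simp: in_set_conv_nth nth_default_def image_iff split: if_splits)
  have span: "int_mod.span (range (coeff f)) = J"
  proof
    show "int_mod.span (range (coeff f)) \<subseteq> J"
      using range(2) int_mod.span_superset[of B] B(2) int_mod.subspace_0[OF J(1)]
      by (intro int_mod.span_minimal J(1)) auto
  qed (use int_mod.span_mono[OF range(1)] B(2) in simp)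
  have coeff_J: "coeff f i \<in> J" for i
    using int_mod.span_base[of "coeff f i" "range (coeff f)"] span by simp
  have coeff_K: "coeffs_in_K f" using coeff_J J(2) O_K by blast
  have "f \<noteq> 0"
  proof
    assume "f = 0"
    then have "range (coeff f) = {0}" by auto
    then have "J \<subseteq> {0}"
      unfolding span[symmetric] by (intro int_mod.span_minimal int_mod.subspace_single_0) simp
    then show False using J(1,3) int_mod.subspace_0 by blast
  qed
  define F where "F = (\<Prod>s\<in>\<Gamma>. map_poly s f)"
  have "map_poly s f \<noteq> 0" if "s \<in> \<Gamma>" for s
  proof -
    obtain i where "coeff f i \<noteq> 0" using \<open>f \<noteq> 0\<close> by (metis leading_coeff_0_iff)
    then have "coeff (map_poly s f) i \<noteq> 0"
      using coeff_K gal_eq_0_iff[OF that] coeff_map_gal[OF that] by simp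
    then show ?thesis by auto
  qed
  then have "F \<noteq> 0" unfolding F_def using finite_gal by auto
  have int_prod: "algebraic_int (coeff (\<Prod>s\<in>A. map_poly s f) i)" if "finite A" "A \<subseteq> \<Gamma>" for A i
    using that
  proof (induction A arbitrary: i rule: finite_induct)
    case empty
    then show ?case by (cases "i = 0") auto
  next
    case (insert s A)
    have "algebraic_int (coeff (map_poly s f) i)" for i
      using insert.prems coeff_J J(2) gal_O O_algebraic_int by (auto simp: coeff_map_gal subset_iff)
    then show ?case
      using insert by (auto simp: coeff_mult intro!: algebraic_int_sum algebraic_int_mult)
  qed
  have F_int: "\<exists>k::int. coeff F i = of_int k" for i
  proof -
    have "coeff F i \<in> \<int>"
      using rational_algebraic_int_is_int[OF int_prod[OF finite_gal subset_refl] norm_poly_Rats[OF coeff_K]]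
      by (simp add: F_def)
    then show ?thesis by (auto elim: Ints_cases)
  qed
  \<comment> \<open>The additive group spanned by the coefficients of \<open>F\<close>, viewed
    inside \<int>; its generator \<open>d\<close> is their gcd up to sign.\<close>
  define H where "H = {k::int. (of_int k :: 'a) \<in> int_mod.span (range (coeff F))}"
  obtain d where d: "d \<in> H" "\<And>k. k \<in> H \<Longrightarrow> d dvd k"
  proof (rule int_subgroup_cyclic[of H])
    show "0 \<in> H" by (simp add: H_def int_mod.span_zero)
    show "x - y \<in> H" if "x \<in> H" "y \<in> H" for x y
      using that int_mod.span_diff by (auto simp: H_def)
  qed blast
  have F_dvd: "\<exists>k::int. coeff F i = of_int d * of_int k" for i
  proof -
    obtain k :: int where k: "coeff F i = of_int k" using F_int by auto
    then have "k \<in> H"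
      using int_mod.span_base[of "coeff F i" "range (coeff F)"] unfolding H_def by (metis mem_Collect_eq rangeI)
    then show ?thesis using d(2)[of k] k by (auto simp: dvd_def)
  qed
  have d0: "d \<noteq> 0"
  proof
    assume "d = 0"
    then have "coeff F i = 0" for i using F_dvd[of i] by auto
    then show False using \<open>F \<noteq> 0\<close> by (simp add: poly_eq_iff)
  qed
  show thesis
  proof (rule that[of "of_int d"])
    show dK: "of_int d \<in> K" using O_K O_of_int by auto
    show "of_int d \<noteq> (0::'a)" using d0 by simp
  next
    fix x :: "('a \<Rightarrow> 'a) \<Rightarrow> 'a" assume x: "\<And>s. s \<in> \<Gamma> \<Longrightarrow> x s \<in> s ` J"
    \<comment> \<open>Every coefficient of \<open>F\<close> is an integer multiple of
      \<open>d\<close>, so \<open>F / d\<close> has integral coefficients; exchanging the conjugate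
      polynomials for elements of their ideals keeps the quotient integral.\<close>
    have "algebraic_int (inverse (of_int d) * (\<Prod>s\<in>\<Gamma>. x s))"
    proof (rule algebraic_int_prod_content[OF finite_gal])
      show "algebraic_int (inverse (of_int d) * coeff (\<Prod>s\<in>\<Gamma>. map_poly s f) i)" for i
        using F_dvd[of i] d0 unfolding F_def[symmetric] by (auto simp flip: mult.assoc)
      fix s assume s: "s \<in> \<Gamma>"
      have "s ` range (coeff f) = range (coeff (map_poly s f))"
        by (auto simp: coeff_map_gal[OF s])
      moreover obtain y where "y \<in> int_mod.span (range (coeff f))" "x s = s y"
        using x[OF s] span by auto
      ultimately show "x s \<in> int_mod.span (range (coeff (map_poly s f)))"
        using image_span_gal[OF s, of "range (coeff f)" y] coeff_K by auto
    qed
    moreover have "x s \<in> K" if s: "s \<in> \<Gamma>" for s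
    proof -
      obtain y where "y \<in> J" "x s = s y" using x[OF s] by auto
      then show ?thesis using gal_closed[OF s, of y] J(2) O_K by auto
    qed
    then have "inverse (of_int d) * (\<Prod>s\<in>\<Gamma>. x s) \<in> K"
      using K_inverse[of "of_int d"] O_K[OF O_of_int] by (intro K_mult K_prod) auto
    ultimately have "inverse (of_int d) * (\<Prod>s\<in>\<Gamma>. x s) \<in> \<O>" by (intro O_I)
    moreover have "(\<Prod>s\<in>\<Gamma>. x s) = of_int d * (inverse (of_int d) * (\<Prod>s\<in>\<Gamma>. x s))"
      using d0 by simp
    ultimately show "(\<Prod>s\<in>\<Gamma>. x s) \<in> (\<lambda>a. of_int d * a) ` \<O>" by blast
  next
    fix M :: "'a set"
    assume M: "int_mod.subspace M"
      "\<And>f i. (\<And>s i. s \<in> \<Gamma> \<Longrightarrow> coeff (f s) i \<in> s ` J) \<Longrightarrow> coeff (\<Prod>s\<in>\<Gamma>. f s) i \<in> M"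
    \<comment> \<open>\<open>F\<close> is one of the products in the assumption on \<open>M\<close>,
      and \<open>d\<close> is an integer combination of its coefficients.\<close>
    have "coeff F i \<in> M" for i
      unfolding F_def by (rule M(2)) (use coeff_J coeff_map_gal in auto)
    then have "int_mod.span (range (coeff F)) \<subseteq> M"
      by (intro int_mod.span_minimal M(1)) auto
    then show "of_int d \<in> M" using d(1) by (auto simp: H_def)
  qed
qed

end

section \<open>The ideal class group\<close>

lemma fractional_ideal_mult_memI:
  assumes "a \<in> I" "b \<in> J"
  shows "a * b \<in> fractional_ideal_mult I J"
  unfolding fractional_ideal_mult_def mem_Collect_eq
  by (intro exI[of _ 1] exI[of _ "\<lambda>_. a"] exI[of _ "\<lambda>_. b"]) (use assms in auto)

lemma zero_mem_fractional_ideal_mult: "0 \<in> fractional_ideal_mult I J"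
  unfolding fractional_ideal_mult_def mem_Collect_eq by (intro exI[of _ 0]) auto

lemma fractional_ideal_mult_add_mult:
  assumes "x \<in> fractional_ideal_mult I J" "u \<in> I" "v \<in> J"
  shows "x + u * v \<in> fractional_ideal_mult I J"
proof -
  obtain n a b where x: "x = (\<Sum>i<n::nat. a i * b i)" "\<And>i. i < n \<Longrightarrow> a i \<in> I" "\<And>i. i < n \<Longrightarrow> b i \<in> J"
    using assms(1) by (auto simp: fractional_ideal_mult_def)
  show ?thesis
    unfolding fractional_ideal_mult_def mem_Collect_eq
    by (intro exI[of _ "Suc n"] exI[of _ "a(n := u)"] exI[of _ "b(n := v)"])
      (use x assms in \<open>auto simp: less_Suc_eq\<close>)
qed

lemma fractional_ideal_mult_add:
  assumes "x \<in> fractional_ideal_mult I J" "y \<in> fractional_ideal_mult I J"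
  shows "x + y \<in> fractional_ideal_mult I J"
proof -
  obtain n a b where y: "y = (\<Sum>i<n::nat. a i * b i)" "\<And>i. i < n \<Longrightarrow> a i \<in> I" "\<And>i. i < n \<Longrightarrow> b i \<in> J"
    using assms(2) by (auto simp: fractional_ideal_mult_def)
  have "x + (\<Sum>i<m. a i * b i) \<in> fractional_ideal_mult I J" if "m \<le> n" for m
    using that
  proof (induction m)
    case (Suc m)
    then show ?case
      using fractional_ideal_mult_add_mult[of "x + (\<Sum>i<m. a i * b i)" I J "a m" "b m"] y
      by (simp add: add.assoc)
  qed (use assms in simp)
  then show ?thesis using y(1) by simp
qed

text \<open>Serves as the induction principle for products: membership is reduced to single products
  \<open>a * b\<close>.\<close>

lemma fractional_ideal_mult_least:
  assumes "x \<in> fractional_ideal_mult I J" "0 \<in> M" "\<And>x y. x \<in> M \<Longrightarrow> y \<in> M \<Longrightarrow> x + y \<in> M"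
    "\<And>a b. a \<in> I \<Longrightarrow> b \<in> J \<Longrightarrow> a * b \<in> M"
  shows "x \<in> M"
proof -
  obtain n a b where x: "x = (\<Sum>i<n::nat. a i * b i)" "\<And>i. i < n \<Longrightarrow> a i \<in> I" "\<And>i. i < n \<Longrightarrow> b i \<in> J"
    using assms(1) by (auto simp: fractional_ideal_mult_def)
  have "(\<Sum>i<m. a i * b i) \<in> M" if "m \<le> n" for m
    using that
  proof (induction m)
    case (Suc m)
    then show ?case using assms(3)[OF _ assms(4)[OF x(2,3)], of "\<Sum>i<m. a i * b i" m m] by simp
  qed (use assms in simp)
  then show ?thesis using x(1) by simp
qed

lemma fractional_ideal_mult_commute: "fractional_ideal_mult I J = fractional_ideal_mult J I"
proof -
  have "x \<in> fractional_ideal_mult J I" if "x \<in> fractional_ideal_mult I J" for x and I J :: "'a set"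
  proof (rule fractional_ideal_mult_least[OF that zero_mem_fractional_ideal_mult fractional_ideal_mult_add])
    show "a * b \<in> fractional_ideal_mult J I" if "a \<in> I" "b \<in> J" for a b
      using fractional_ideal_mult_memI[OF that(2,1)] by (simp add: mult.commute)
  qed
  then show ?thesis by blast
qed

lemma fractional_ideal_mult_assoc:
  "fractional_ideal_mult (fractional_ideal_mult I J) L = fractional_ideal_mult I (fractional_ideal_mult J L)"
proof -
  have sub: "x \<in> fractional_ideal_mult I (fractional_ideal_mult J L)"
    if x: "x \<in> fractional_ideal_mult (fractional_ideal_mult I J) L" for x and I J L :: "'a set"
  proof (rule fractional_ideal_mult_least[OF x zero_mem_fractional_ideal_mult fractional_ideal_mult_add])
    fix y l assume y: "y \<in> fractional_ideal_mult I J" and l: "l \<in> L"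
    have "y \<in> {y. y * l \<in> fractional_ideal_mult I (fractional_ideal_mult J L)}"
    proof (rule fractional_ideal_mult_least[OF y])
      fix a b assume "a \<in> I" "b \<in> J"
      then show "a * b \<in> {y. y * l \<in> fractional_ideal_mult I (fractional_ideal_mult J L)}"
        using l by (simp add: mult.assoc fractional_ideal_mult_memI)
    qed (auto simp: zero_mem_fractional_ideal_mult distrib_right intro: fractional_ideal_mult_add)
    then show "y * l \<in> fractional_ideal_mult I (fractional_ideal_mult J L)" by simp
  qed
  show ?thesis
  proof
    show "fractional_ideal_mult (fractional_ideal_mult I J) L \<subseteq> fractional_ideal_mult I (fractional_ideal_mult J L)"
      using sub by blast
    \<comment> \<open>Commutativity turns the reverse inclusion into the one already proved, for
      \<open>L\<close>, \<open>J\<close>, \<open>I\<close> in this order.\<close>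
    have eq: "fractional_ideal_mult I (fractional_ideal_mult J L) = fractional_ideal_mult (fractional_ideal_mult L J) I"
      "fractional_ideal_mult (fractional_ideal_mult I J) L = fractional_ideal_mult L (fractional_ideal_mult J I)"
      by (metis fractional_ideal_mult_commute)+
    have "x \<in> fractional_ideal_mult (fractional_ideal_mult I J) L"
      if "x \<in> fractional_ideal_mult I (fractional_ideal_mult J L)" for x
      using sub[of x L J I] that unfolding eq .
    then show "fractional_ideal_mult I (fractional_ideal_mult J L) \<subseteq> fractional_ideal_mult (fractional_ideal_mult I J) L"
      by blast
  qed
qed

lemma (in comm_group) finprod_group_hom:
  assumes H: "comm_group H" and h: "h \<in> hom G H" and f: "f \<in> A \<rightarrow> carrier G"
  shows "h (finprod G f A) = finprod H (\<lambda>a. h (f a)) A"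
proof -
  interpret H: comm_group H by (rule H)
  show ?thesis
    using f
  proof (induction A rule: infinite_finite_induct)
    case (insert a A)
    have hf: "(\<lambda>a. h (f a)) \<in> A \<rightarrow> carrier H" "h (f a) \<in> carrier H"
      using insert.prems h by (auto simp: hom_def)
    have "finprod G f (insert a A) = f a \<otimes> finprod G f A"
      using insert by (intro finprod_insert) auto
    moreover have "finprod H (\<lambda>a. h (f a)) (insert a A) = h (f a) \<otimes>\<^bsub>H\<^esub> finprod H (\<lambda>a. h (f a)) A"
      using insert.hyps hf by (intro H.finprod_insert) auto
    moreover have "h (f a \<otimes> finprod G f A) = h (f a) \<otimes>\<^bsub>H\<^esub> h (finprod G f A)"
      using insert.prems by (intro hom_mult[OF h]) auto
    moreover have "h (finprod G f A) = finprod H (\<lambda>a. h (f a)) A"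
      using insert.prems by (intro insert.IH) auto
    ultimately show ?case by simp
  qed (use hom_one[OF h is_group H.is_group] in auto)
qed

context galois_field
begin

section \<open>The monoid of fractional ideals\<close>

abbreviation "IG \<equiv> ideal_group K"

abbreviation principal :: "'a \<Rightarrow> 'a set" where
  "principal x \<equiv> (\<lambda>a. x * a) ` \<O>"

lemma carrier_IG: "I \<in> carrier IG \<longleftrightarrow> fractional_ideal K I \<and> I \<noteq> {0}"
  and mult_IG: "I \<otimes>\<^bsub>IG\<^esub> J = fractional_ideal_mult I J"
  and one_IG: "\<one>\<^bsub>IG\<^esub> = \<O>"
  by (simp_all add: ideal_group_def)

lemma IG_D:
  assumes "I \<in> carrier IG"
  shows IG_K: "x \<in> I \<Longrightarrow> x \<in> K" and IG_0: "0 \<in> I"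
    and IG_add: "x \<in> I \<Longrightarrow> y \<in> I \<Longrightarrow> x + y \<in> I"
    and IG_O_mult: "a \<in> \<O> \<Longrightarrow> x \<in> I \<Longrightarrow> a * x \<in> I"
    and IG_denominator: "\<exists>d\<in>\<O>. d \<noteq> 0 \<and> (\<forall>x\<in>I. d * x \<in> \<O>)"
    and IG_nonzero: "\<exists>x\<in>I. x \<noteq> 0"
  using assms by (auto simp: carrier_IG fractional_ideal_def)

lemma IG_minus: "I \<in> carrier IG \<Longrightarrow> x \<in> I \<Longrightarrow> - x \<in> I"
  using IG_O_mult[OF _ O_minus[OF O_1]] by fastforce

lemma IG_subspace: "I \<in> carrier IG \<Longrightarrow> int_mod.subspace I"
  by (intro int_mod_subspaceI IG_0 IG_add IG_minus)

lemma IG_I: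
  assumes "I \<subseteq> K" "0 \<in> I" "\<And>x y. x \<in> I \<Longrightarrow> y \<in> I \<Longrightarrow> x + y \<in> I"
    "\<And>a x. a \<in> \<O> \<Longrightarrow> x \<in> I \<Longrightarrow> a * x \<in> I"
    "d \<in> \<O>" "d \<noteq> 0" "\<And>x. x \<in> I \<Longrightarrow> d * x \<in> \<O>" "y \<in> I" "y \<noteq> 0"
  shows "I \<in> carrier IG"
  using assms unfolding carrier_IG fractional_ideal_def by blast

lemma principal_carrier:
  assumes "x \<in> K" "x \<noteq> 0"
  shows "principal x \<in> carrier IG"
proof -
  obtain m :: int where m: "m \<noteq> 0" "algebraic_int (of_int m * x)"
    using integral_multiple[OF assms(1)] .
  then have mx: "of_int m * x \<in> \<O>" using K_mult[OF O_K[OF O_of_int] assms(1)] O_I by blast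
  show ?thesis
  proof (rule IG_I)
    show "principal x \<subseteq> K" using assms(1) K_mult O_K by auto
    show "0 \<in> principal x" using O_0 by force
    show "a + b \<in> principal x" if "a \<in> principal x" "b \<in> principal x" for a b
      using that O_add by (auto simp: distrib_left[symmetric])
    show "a * b \<in> principal x" if "a \<in> \<O>" "b \<in> principal x" for a b
      using that O_mult by (auto simp: mult.left_commute)
    show "of_int m \<in> \<O>" by (rule O_of_int)
    show "of_int m \<noteq> (0::'a)" using m(1) by simp
    show "of_int m * y \<in> \<O>" if "y \<in> principal x" for y
      using that O_mult[OF mx] by (auto simp: mult.assoc)
    show "x \<in> principal x" using O_1 by force
  qed (rule assms(2))
qed

lemma IG_mult_closed:
  assumes I: "I \<in> carrier IG" and J: "J \<in> carrier IG"
  shows "fractional_ideal_mult I J \<in> carrier IG"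
proof -
  obtain d where d: "d \<in> \<O>" "d \<noteq> 0" "\<forall>x\<in>I. d * x \<in> \<O>" using IG_denominator[OF I] by auto
  obtain e where e: "e \<in> \<O>" "e \<noteq> 0" "\<forall>x\<in>J. e * x \<in> \<O>" using IG_denominator[OF J] by auto
  obtain x y where xy: "x \<in> I" "x \<noteq> 0" "y \<in> J" "y \<noteq> 0" using IG_nonzero I J by meson
  show ?thesis
  proof (rule IG_I)
    show "fractional_ideal_mult I J \<subseteq> K"
    proof
      fix z assume "z \<in> fractional_ideal_mult I J"
      then show "z \<in> K"
        by (rule fractional_ideal_mult_least) (use K_0 K_add K_mult IG_K I J in auto)
    qed
    show "a * z \<in> fractional_ideal_mult I J" if a: "a \<in> \<O>" and z: "z \<in> fractional_ideal_mult I J" for a z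
    proof -
      have "z \<in> {z. a * z \<in> fractional_ideal_mult I J}"
      proof (rule fractional_ideal_mult_least[OF z])
        show "u * v \<in> {z. a * z \<in> fractional_ideal_mult I J}" if "u \<in> I" "v \<in> J" for u v
          using fractional_ideal_mult_memI[OF IG_O_mult[OF I a that(1)] that(2)] by (simp add: mult.assoc)
      qed (auto simp: zero_mem_fractional_ideal_mult distrib_left intro: fractional_ideal_mult_add)
      then show ?thesis by simp
    qed
    show "d * e \<in> \<O>" using d e O_mult by blast
    show "d * e \<noteq> 0" using d e by simp
    show "d * e * z \<in> \<O>" if z: "z \<in> fractional_ideal_mult I J" for z
    proof -
      have "z \<in> {z. d * e * z \<in> \<O>}"
      proof (rule fractional_ideal_mult_least[OF z])
        show "u * v \<in> {z. d * e * z \<in> \<O>}" if "u \<in> I" "v \<in> J" for u v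
          using O_mult[of "d * u" "e * v"] d(3) e(3) that by (simp add: mult_ac)
      qed (auto simp: O_0 distrib_left intro: O_add)
      then show ?thesis by simp
    qed
    show "x * y \<in> fractional_ideal_mult I J" using xy fractional_ideal_mult_memI by blast
    show "x * y \<noteq> 0" using xy by simp
  qed (auto intro: zero_mem_fractional_ideal_mult fractional_ideal_mult_add)
qed

lemma principal_mult:
  assumes "I \<in> carrier IG"
  shows "fractional_ideal_mult (principal x) I = (\<lambda>a. x * a) ` I"
proof
  show "(\<lambda>a. x * a) ` I \<subseteq> fractional_ideal_mult (principal x) I"
    using fractional_ideal_mult_memI[of x "principal x"] O_1 by force
  show "fractional_ideal_mult (principal x) I \<subseteq> (\<lambda>a. x * a) ` I"
  proof
    fix z assume "z \<in> fractional_ideal_mult (principal x) I"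
    then show "z \<in> (\<lambda>a. x * a) ` I"
    proof (rule fractional_ideal_mult_least)
      show "0 \<in> (\<lambda>a. x * a) ` I" using IG_0[OF assms] by force
      show "a + b \<in> (\<lambda>a. x * a) ` I" if "a \<in> (\<lambda>a. x * a) ` I" "b \<in> (\<lambda>a. x * a) ` I" for a b
        using that IG_add[OF assms] by (auto simp: distrib_left[symmetric])
      show "a * b \<in> (\<lambda>a. x * a) ` I" if "a \<in> principal x" "b \<in> I" for a b
        using that IG_O_mult[OF assms] by (auto simp: mult.assoc)
    qed
  qed
qed

lemma principal_mult_principal:
  assumes "x \<in> K" "x \<noteq> 0" "y \<in> K" "y \<noteq> 0"
  shows "principal x \<otimes>\<^bsub>IG\<^esub> principal y = principal (x * y)"
  using principal_mult[OF principal_carrier[OF assms(3,4)], of x]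
  by (simp add: mult_IG image_image mult.assoc)

text \<open>Finite products already make sense in a commutative monoid, so norms of ideals are
  available for the proof that ideals are invertible.\<close>

lemma comm_monoid_IG: "comm_monoid IG"
proof (rule comm_monoidI)
  show "\<one>\<^bsub>IG\<^esub> \<in> carrier IG" using principal_carrier[OF K_1] by (simp add: one_IG)
  show "\<one>\<^bsub>IG\<^esub> \<otimes>\<^bsub>IG\<^esub> I = I" if "I \<in> carrier IG" for I
    using principal_mult[OF that, of 1] by (simp add: one_IG mult_IG)
  show "I \<otimes>\<^bsub>IG\<^esub> J = J \<otimes>\<^bsub>IG\<^esub> I" for I J
    unfolding mult_IG by (rule fractional_ideal_mult_commute)
qed (auto simp: mult_IG IG_mult_closed fractional_ideal_mult_assoc)

section \<open>The Galois action on ideals\<close>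

lemma gal_image_K: "s \<in> \<Gamma> \<Longrightarrow> s ` K = K"
  using gal_bij by (simp add: bij_betw_def)

text \<open>The inverse automorphism preserves integrality too. This surjectivity on
  \<open>\<O>\<close> makes the images of ideals closed under multiplication by
  \<open>\<O>\<close>.\<close>

lemma gal_inv_O:
  assumes "s \<in> \<Gamma>" "y \<in> \<O>"
  obtains x where "x \<in> \<O>" "s x = y"
proof -
  interpret G: group Gal by (rule group_Gal)
  define t where "t = inv\<^bsub>Gal\<^esub> s"
  have t: "t \<in> \<Gamma>" using G.inv_closed assms(1) by (simp add: t_def carrier_Gal)
  have "compose K s t = (\<lambda>x\<in>K. x)"
    using G.r_inv[of s] t assms(1) by (simp add: carrier_Gal one_Gal t_def[symmetric] mult_Gal)
  then have "s (t y) = y" using O_K[OF assms(2)] by (metis compose_eq restrict_apply')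
  then show thesis using that gal_O[OF t assms(2)] by blast
qed

lemma gal_image_principal:
  assumes "s \<in> \<Gamma>" "x \<in> K"
  shows "s ` principal x = principal (s x)"
proof
  show "s ` principal x \<subseteq> principal (s x)"
    using assms gal_mult[OF assms(1)] gal_O[OF assms(1)] O_K by auto
  show "principal (s x) \<subseteq> s ` principal x"
  proof
    fix z assume "z \<in> principal (s x)"
    then obtain b where b: "b \<in> \<O>" "z = s x * b" by auto
    obtain a where a: "a \<in> \<O>" "s a = b" using gal_inv_O[OF assms(1) b(1)] .
    have "z = s (x * a)" using gal_mult[OF assms O_K[OF a(1)]] a b by simp
    then show "z \<in> s ` principal x" using a(1) by blast
  qed
qed

lemma gal_image_carrier:
  assumes s: "s \<in> \<Gamma>" and I: "I \<in> carrier IG"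
  shows "s ` I \<in> carrier IG"
proof -
  obtain d where d: "d \<in> \<O>" "d \<noteq> 0" "\<forall>x\<in>I. d * x \<in> \<O>" using IG_denominator[OF I] by auto
  obtain x where x: "x \<in> I" "x \<noteq> 0" using IG_nonzero[OF I] by auto
  show ?thesis
  proof (rule IG_I)
    show "s ` I \<subseteq> K" using gal_closed[OF s] IG_K[OF I] by auto
    show "0 \<in> s ` I" using gal_0[OF s] IG_0[OF I] by force
    show "u + v \<in> s ` I" if uv: "u \<in> s ` I" "v \<in> s ` I" for u v
    proof -
      obtain a b where "a \<in> I" "u = s a" "b \<in> I" "v = s b" using uv by blast
      then show ?thesis using gal_add[OF s IG_K[OF I] IG_K[OF I], of a b] IG_add[OF I, of a b]
        by (metis imageI)
    qed
    show "a * u \<in> s ` I" if a: "a \<in> \<O>" and u: "u \<in> s ` I" for a u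
    proof -
      obtain b where b: "b \<in> I" "u = s b" using u by blast
      obtain c where c: "c \<in> \<O>" "s c = a" using gal_inv_O[OF s a] .
      have "s (c * b) = a * u" using gal_mult[OF s O_K[OF c(1)] IG_K[OF I b(1)]] b c by simp
      then show ?thesis using IG_O_mult[OF I c(1) b(1)] by (metis imageI)
    qed
    show "s d \<in> \<O>" by (rule gal_O[OF s d(1)])
    show "s d \<noteq> 0" using gal_eq_0_iff[OF s O_K[OF d(1)]] d(2) by simp
    show "s d * u \<in> \<O>" if "u \<in> s ` I" for u
    proof -
      obtain b where b: "b \<in> I" "u = s b" using \<open>u \<in> s ` I\<close> by blast
      then show ?thesis using gal_mult[OF s O_K[OF d(1)] IG_K[OF I b(1)]] gal_O[OF s, of "d * b"] d(3) by auto
    qed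
    show "s x \<in> s ` I" using x by blast
    show "s x \<noteq> 0" using gal_eq_0_iff[OF s IG_K[OF I x(1)]] x(2) by simp
  qed
qed

lemma gal_image_mult:
  assumes s: "s \<in> \<Gamma>" and I: "I \<in> carrier IG" and J: "J \<in> carrier IG"
  shows "s ` (I \<otimes>\<^bsub>IG\<^esub> J) = s ` I \<otimes>\<^bsub>IG\<^esub> s ` J"
  unfolding mult_IG
proof
  show "s ` fractional_ideal_mult I J \<subseteq> fractional_ideal_mult (s ` I) (s ` J)"
  proof -
    have "x \<in> {x \<in> K. s x \<in> fractional_ideal_mult (s ` I) (s ` J)}" if x: "x \<in> fractional_ideal_mult I J" for x
    proof (rule fractional_ideal_mult_least[OF x])
      show "0 \<in> {x \<in> K. s x \<in> fractional_ideal_mult (s ` I) (s ` J)}"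
        using K_0 gal_0[OF s] zero_mem_fractional_ideal_mult by simp
      show "a + b \<in> {x \<in> K. s x \<in> fractional_ideal_mult (s ` I) (s ` J)}"
        if "a \<in> {x \<in> K. s x \<in> fractional_ideal_mult (s ` I) (s ` J)}"
          "b \<in> {x \<in> K. s x \<in> fractional_ideal_mult (s ` I) (s ` J)}" for a b
        using that K_add gal_add[OF s] fractional_ideal_mult_add by auto
      show "a * b \<in> {x \<in> K. s x \<in> fractional_ideal_mult (s ` I) (s ` J)}" if "a \<in> I" "b \<in> J" for a b
      proof -
        have ab: "a \<in> K" "b \<in> K" using that IG_K I J by auto
        show ?thesis
          using fractional_ideal_mult_memI[OF imageI[OF that(1), of s] imageI[OF that(2), of s]]
            gal_mult[OF s ab] K_mult[OF ab] by simp
      qed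
    qed
    then show ?thesis by blast
  qed
  show "fractional_ideal_mult (s ` I) (s ` J) \<subseteq> s ` fractional_ideal_mult I J"
  proof
    note IJ = IG_mult_closed[OF I J]
    note sIJ = gal_image_carrier[OF s IJ]
    fix x assume "x \<in> fractional_ideal_mult (s ` I) (s ` J)"
    then show "x \<in> s ` fractional_ideal_mult I J"
    proof (rule fractional_ideal_mult_least[OF _ IG_0[OF sIJ] IG_add[OF sIJ]])
      fix u v assume "u \<in> s ` I" "v \<in> s ` J"
      then obtain a b where ab: "a \<in> I" "u = s a" "b \<in> J" "v = s b" by blast
      have "u * v = s (a * b)" using gal_mult[OF s IG_K[OF I ab(1)] IG_K[OF J ab(3)]] ab by simp
      then show "u * v \<in> s ` fractional_ideal_mult I J"
        using fractional_ideal_mult_memI[OF ab(1,3)] by blast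
    qed
  qed
qed

section \<open>Norms as products of conjugate ideals\<close>

lemma coeff_prod_mem_finprod:
  assumes "finite A" "\<And>s. s \<in> A \<Longrightarrow> I s \<in> carrier IG" "\<And>s i. s \<in> A \<Longrightarrow> coeff (f s) i \<in> I s"
  shows "coeff (\<Prod>s\<in>A. f s) i \<in> finprod IG I A"
  using assms
proof (induction A arbitrary: i rule: finite_induct)
  case empty
  interpret comm_monoid IG by (rule comm_monoid_IG)
  show ?case using O_0 O_1 by (simp add: one_IG)
next
  case (insert s A)
  interpret comm_monoid IG by (rule comm_monoid_IG)
  have fin: "finprod IG I (insert s A) = fractional_ideal_mult (I s) (finprod IG I A)"
    using insert by (subst finprod_insert) (auto simp: mult_IG)
  have c: "fractional_ideal_mult (I s) (finprod IG I A) \<in> carrier IG"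
    using insert.prems by (intro IG_mult_closed finprod_closed) auto
  have "coeff (f s * prod f A) i \<in> fractional_ideal_mult (I s) (finprod IG I A)"
    unfolding coeff_mult using insert
    by (intro int_mod.subspace_sum[OF IG_subspace[OF c]] fractional_ideal_mult_memI) auto
  then show ?case using insert.hyps fin by simp
qed

text \<open>Elements of the product ideal are built from products with one factor in each ideal, so
  testing these suffices. The scalar \<open>e\<close> accumulates the factors already chosen during
  the induction.\<close>

lemma finprod_ideal_least:
  assumes "finite A" "\<And>s. s \<in> A \<Longrightarrow> I s \<in> carrier IG" and M: "M \<in> carrier IG"
    and "\<And>x. (\<And>s. s \<in> A \<Longrightarrow> x s \<in> I s) \<Longrightarrow> e * (\<Prod>s\<in>A. x s) \<in> M"
    and "y \<in> finprod IG I A"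
  shows "e * y \<in> M"
  using assms(1,2,4-)
proof (induction A arbitrary: e y rule: finite_induct)
  case empty
  interpret comm_monoid IG by (rule comm_monoid_IG)
  have "e \<in> M" using empty.prems(2)[of "\<lambda>_. 0"] by simp
  then show ?case using empty.prems(3) IG_O_mult[OF M, of y e] by (simp add: one_IG mult.commute)
next
  case (insert s A)
  interpret comm_monoid IG by (rule comm_monoid_IG)
  have "finprod IG I (insert s A) = fractional_ideal_mult (I s) (finprod IG I A)"
    using insert.hyps insert.prems(1) by (subst finprod_insert) (auto simp: mult_IG)
  then have "y \<in> fractional_ideal_mult (I s) (finprod IG I A)" using insert.prems(3) by simp
  then have "y \<in> {y. e * y \<in> M}"
  proof (rule fractional_ideal_mult_least)
    fix a b assume a: "a \<in> I s" and b: "b \<in> finprod IG I A"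
    have "e * a * b \<in> M"
    proof (rule insert.IH[OF _ _ b])
      fix x assume x: "\<And>s. s \<in> A \<Longrightarrow> x s \<in> I s"
      have "e * (\<Prod>t\<in>insert s A. (x(s := a)) t) \<in> M"
        by (rule insert.prems(2)) (use a x in auto)
      moreover have "(\<Prod>t\<in>A. (x(s := a)) t) = (\<Prod>t\<in>A. x t)"
        using insert.hyps by (intro prod.cong) auto
      ultimately show "e * a * (\<Prod>s\<in>A. x s) \<in> M"
        using insert.hyps by (simp add: mult.assoc)
    qed (use insert.prems in auto)
    then show "a * b \<in> {y. e * y \<in> M}" by (simp add: mult.assoc)
  qed (use IG_0[OF M] IG_add[OF M] in \<open>auto simp: distrib_left\<close>)
  then show ?case by simp
qed

text \<open>Both inclusions come from \<open>norm_ideal_principal\<close>: \<open>d\<close> lies in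
  any additive group that contains the coefficients of products of polynomials over the conjugates
  of \<open>J\<close>, and the product ideal is such a group; conversely, products of elements of
  the conjugates are multiples of \<open>d\<close>.\<close>

lemma ideal_norm_principal:
  assumes J: "J \<in> carrier IG" "J \<subseteq> \<O>"
  obtains d where "d \<in> K" "d \<noteq> 0" "finprod IG (\<lambda>s. s ` J) \<Gamma> = principal d"
proof -
  interpret comm_monoid IG by (rule comm_monoid_IG)
  have J0: "J \<noteq> {0}" using J(1) by (simp add: carrier_IG)
  have c: "s ` J \<in> carrier IG" if "s \<in> \<Gamma>" for s using gal_image_carrier[OF that J(1)] .
  obtain d :: 'a where d: "d \<in> K" "d \<noteq> 0"
    "\<And>x. (\<And>s. s \<in> \<Gamma> \<Longrightarrow> x s \<in> s ` J) \<Longrightarrow> (\<Prod>s\<in>\<Gamma>. x s) \<in> principal d"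
    "\<And>M. int_mod.subspace M \<Longrightarrow>
      (\<And>f i. (\<And>s i. s \<in> \<Gamma> \<Longrightarrow> coeff (f s) i \<in> s ` J) \<Longrightarrow> coeff (\<Prod>s\<in>\<Gamma>. f s) i \<in> M) \<Longrightarrow> d \<in> M"
    by (rule norm_ideal_principal[OF IG_subspace[OF J(1)] J(2) J0]) blast
  let ?N = "finprod IG (\<lambda>s. s ` J) \<Gamma>"
  have N: "?N \<in> carrier IG" using c by (intro finprod_closed) auto
  have "d \<in> ?N"
  proof (rule d(4)[OF IG_subspace[OF N]])
    fix f :: "('a \<Rightarrow> 'a) \<Rightarrow> 'a poly" and i
    assume *: "\<And>s i. s \<in> \<Gamma> \<Longrightarrow> coeff (f s) i \<in> s ` J"
    show "coeff (\<Prod>s\<in>\<Gamma>. f s) i \<in> ?N" by (rule coeff_prod_mem_finprod[OF finite_gal c *])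
  qed
  then have "principal d \<subseteq> ?N" using IG_O_mult[OF N] by (auto simp: mult.commute)
  moreover have "?N \<subseteq> principal d"
  proof
    fix y assume y: "y \<in> ?N"
    have "1 * y \<in> principal d"
      by (rule finprod_ideal_least[OF finite_gal c principal_carrier[OF d(1,2)] _ y]) (use d(3) in auto)
    then show "y \<in> principal d" by simp
  qed
  ultimately show thesis using that d by blast
qed

text \<open>Multiplication by a common denominator makes the ideal integral without changing its
  class.\<close>

lemma integral_representative:
  assumes "I \<in> carrier IG"
  obtains d where "d \<in> K" "d \<noteq> 0" "principal d \<otimes>\<^bsub>IG\<^esub> I \<in> carrier IG" "principal d \<otimes>\<^bsub>IG\<^esub> I \<subseteq> \<O>"
proof -
  obtain d where d: "d \<in> \<O>" "d \<noteq> 0" "\<forall>x\<in>I. d * x \<in> \<O>" using IG_denominator[OF assms] by auto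
  show thesis
  proof (rule that[of d])
    show "principal d \<otimes>\<^bsub>IG\<^esub> I \<in> carrier IG"
      unfolding mult_IG using assms d O_K by (intro IG_mult_closed principal_carrier) auto
    show "principal d \<otimes>\<^bsub>IG\<^esub> I \<subseteq> \<O>"
      unfolding mult_IG principal_mult[OF assms] using d(3) by auto
  qed (use d O_K in auto)
qed

text \<open>Every ideal divides its norm, which is principal; so ideals are invertible.\<close>

theorem comm_group_IG: "comm_group IG"
proof -
  interpret comm_monoid IG by (rule comm_monoid_IG)
  have "\<exists>L\<in>carrier IG. L \<otimes>\<^bsub>IG\<^esub> I = \<one>\<^bsub>IG\<^esub>" if I: "I \<in> carrier IG" for I
  proof -
    obtain e where e: "e \<in> K" "e \<noteq> 0" and J: "principal e \<otimes>\<^bsub>IG\<^esub> I \<in> carrier IG" "principal e \<otimes>\<^bsub>IG\<^esub> I \<subseteq> \<O>"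
      by (rule integral_representative[OF I])
    define J where "J = principal e \<otimes>\<^bsub>IG\<^esub> I"
    note J = J[folded J_def]
    obtain d where d: "d \<in> K" "d \<noteq> 0" "finprod IG (\<lambda>s. s ` J) \<Gamma> = principal d"
      by (rule ideal_norm_principal[OF J])
    let ?i = "\<lambda>x\<in>K. x"
    \<comment> \<open>The conjugates under all automorphisms except the identity multiply to the
      cofactor of \<open>J\<close> in its norm.\<close>
    define Y where "Y = finprod IG (\<lambda>s. s ` J) (\<Gamma> - {?i})"
    have Y: "Y \<in> carrier IG"
      unfolding Y_def using gal_image_carrier[OF _ J(1)] by (intro finprod_closed) auto
    have "finprod IG (\<lambda>s. s ` J) (insert ?i (\<Gamma> - {?i})) = ?i ` J \<otimes>\<^bsub>IG\<^esub> Y"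
      unfolding Y_def
    proof (rule finprod_insert)
      show "?i ` J \<in> carrier IG" by (rule gal_image_carrier[OF id_gal J(1)])
    qed (use finite_gal gal_image_carrier[OF _ J(1)] in auto)
    moreover have "insert ?i (\<Gamma> - {?i}) = \<Gamma>" using id_gal by auto
    moreover have "?i ` J = (\<lambda>x. x) ` J"
      by (rule image_cong) (use IG_K[OF J(1)] in simp_all)
    then have "?i ` J = J" by simp
    ultimately have JX: "J \<otimes>\<^bsub>IG\<^esub> Y = principal d" using d(3) by simp
    define D where "D = principal (inverse d)"
    have inv: "inverse d \<in> K" "inverse d \<noteq> 0" using K_inverse d by auto
    have c: "D \<in> carrier IG" "principal e \<in> carrier IG"
      using principal_carrier inv e by (auto simp: D_def)
    \<comment> \<open>The inverse of \<open>I\<close> is \<open>principal e\<close> times the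
      cofactor \<open>Y\<close>, divided by the generator \<open>d\<close> of the norm.\<close>
    have "(D \<otimes>\<^bsub>IG\<^esub> Y \<otimes>\<^bsub>IG\<^esub> principal e) \<otimes>\<^bsub>IG\<^esub> I = D \<otimes>\<^bsub>IG\<^esub> (J \<otimes>\<^bsub>IG\<^esub> Y)"
      using c Y I unfolding J_def by (simp add: m_ac)
    also have "\<dots> = \<one>\<^bsub>IG\<^esub>"
      unfolding JX D_def using principal_mult_principal[OF inv d(1,2)] d(2) by (simp add: one_IG)
    finally show ?thesis using c Y by blast
  qed
  then have "group IG"
    by (intro monoid.group_l_invI comm_monoid.axioms(1)[OF comm_monoid_IG]) blast
  then show ?thesis by (rule group.group_comm_groupI) (rule m_comm)
qed

section \<open>The class group and the Galois action on it\<close>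

abbreviation "\<P> \<equiv> principal_ideals K"

lemma principal_in_P: "x \<in> K \<Longrightarrow> x \<noteq> 0 \<Longrightarrow> principal x \<in> \<P>"
  by (auto simp: principal_ideals_def)

lemma subgroup_P: "subgroup \<P> IG"
proof -
  interpret comm_group IG by (rule comm_group_IG)
  show ?thesis
  proof (rule subgroupI)
    show "\<P> \<subseteq> carrier IG" using principal_carrier by (auto simp: principal_ideals_def)
    show "\<P> \<noteq> {}" using principal_in_P[OF K_1] by auto
    show "I \<otimes>\<^bsub>IG\<^esub> J \<in> \<P>" if "I \<in> \<P>" "J \<in> \<P>" for I J
    proof -
      obtain x y where xy: "x \<in> K" "x \<noteq> 0" "I = principal x" "y \<in> K" "y \<noteq> 0" "J = principal y"
        using \<open>I \<in> \<P>\<close> \<open>J \<in> \<P>\<close> unfolding principal_ideals_def by blast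
      then show ?thesis using principal_mult_principal[of x y] principal_in_P[of "x * y"] K_mult by simp
    qed
    show "inv\<^bsub>IG\<^esub> I \<in> \<P>" if "I \<in> \<P>" for I
    proof -
      obtain x where x: "x \<in> K" "x \<noteq> 0" "I = principal x"
        using \<open>I \<in> \<P>\<close> unfolding principal_ideals_def by blast
      have ix: "inverse x \<in> K" "inverse x \<noteq> 0" using K_inverse x by auto
      have "principal (inverse x) \<otimes>\<^bsub>IG\<^esub> I = \<one>\<^bsub>IG\<^esub>"
        using principal_mult_principal[OF ix x(1,2)] x by (simp add: one_IG)
      then have "inv\<^bsub>IG\<^esub> I = principal (inverse x)"
        using x ix principal_carrier by (intro inv_equality) auto
      then show ?thesis using principal_in_P[OF ix] by simp
    qed
  qed
qed

abbreviation "ideal_class I \<equiv> \<P> #>\<^bsub>IG\<^esub> I"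

lemma normal_P: "\<P> \<lhd> IG"
  using comm_group.subgroup_imp_normal[OF comm_group_IG subgroup_P] .

lemma comm_group_class_group: "comm_group (class_group K)"
  unfolding class_group_def by (rule comm_group.abelian_FactGroup[OF comm_group_IG subgroup_P])

lemma ideal_class_hom: "ideal_class \<in> hom IG (class_group K)"
  unfolding class_group_def by (rule normal.r_coset_hom_Mod[OF normal_P])

lemma carrier_class_group: "C \<in> carrier (class_group K) \<longleftrightarrow> (\<exists>I\<in>carrier IG. C = ideal_class I)"
  by (auto simp: class_group_def FactGroup_def RCOSETS_def)

lemma ideal_class_principal:
  assumes "d \<in> K" "d \<noteq> 0"
  shows "ideal_class (principal d) = \<one>\<^bsub>class_group K\<^esub>"
  using group.coset_join2[OF comm_group.axioms(2)[OF comm_group_IG] _ subgroup_P principal_in_P]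
    principal_carrier assms
  by (simp add: class_group_def FactGroup_def)

text \<open>Automorphisms permute the principal ideals, so they carry cosets to cosets. The image is
  taken twice because a class is a set of ideals, which are sets of numbers.\<close>

lemma gal_image_ideal_class:
  assumes s: "s \<in> \<Gamma>" and I: "I \<in> carrier IG"
  shows "(`) s ` ideal_class I = ideal_class (s ` I)"
proof
  show "(`) s ` ideal_class I \<subseteq> ideal_class (s ` I)"
  proof
    fix Y assume "Y \<in> (`) s ` ideal_class I"
    then obtain x where x: "x \<in> K" "x \<noteq> 0" "Y = s ` (principal x \<otimes>\<^bsub>IG\<^esub> I)"
      by (auto simp: r_coset_def principal_ideals_def)
    then have "Y = principal (s x) \<otimes>\<^bsub>IG\<^esub> s ` I"
      using gal_image_mult[OF s principal_carrier I] gal_image_principal[OF s] by simp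
    moreover have "principal (s x) \<in> \<P>"
      using x gal_closed[OF s] gal_eq_0_iff[OF s] by (intro principal_in_P) auto
    ultimately show "Y \<in> ideal_class (s ` I)" by (auto simp: r_coset_def)
  qed
  show "ideal_class (s ` I) \<subseteq> (`) s ` ideal_class I"
  proof
    fix Y assume "Y \<in> ideal_class (s ` I)"
    then obtain y where y: "y \<in> K" "y \<noteq> 0" "Y = principal y \<otimes>\<^bsub>IG\<^esub> s ` I"
      by (auto simp: r_coset_def principal_ideals_def)
    obtain x where x: "x \<in> K" "y = s x" using gal_image_K[OF s] y(1) by blast
    have x0: "x \<noteq> 0" using x y(2) gal_0[OF s] by auto
    have "Y = s ` (principal x \<otimes>\<^bsub>IG\<^esub> I)"
      using gal_image_mult[OF s principal_carrier[OF x(1) x0] I] gal_image_principal[OF s x(1)] y(3) x(2)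
      by simp
    moreover have "principal x \<otimes>\<^bsub>IG\<^esub> I \<in> ideal_class I"
      using principal_in_P[OF x(1) x0] by (auto simp: r_coset_def)
    ultimately show "Y \<in> (`) s ` ideal_class I" by blast
  qed
qed

lemma gal_image_hom_class_group:
  assumes s: "s \<in> \<Gamma>"
  shows "(`) ((`) s) \<in> hom (class_group K) (class_group K)"
proof (rule homI)
  show "(`) s ` C \<in> carrier (class_group K)" if "C \<in> carrier (class_group K)" for C
    using that gal_image_ideal_class[OF s] gal_image_carrier[OF s] unfolding carrier_class_group by metis
  fix C D assume "C \<in> carrier (class_group K)" "D \<in> carrier (class_group K)"
  then obtain I J where IJ: "I \<in> carrier IG" "C = ideal_class I" "J \<in> carrier IG" "D = ideal_class J"
    by (auto simp: carrier_class_group)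
  have c: "I \<otimes>\<^bsub>IG\<^esub> J \<in> carrier IG" using IG_mult_closed IJ by (simp add: mult_IG)
  have "C \<otimes>\<^bsub>class_group K\<^esub> D = ideal_class (I \<otimes>\<^bsub>IG\<^esub> J)"
    using hom_mult[OF ideal_class_hom] IJ by simp
  then have "(`) s ` (C \<otimes>\<^bsub>class_group K\<^esub> D) = ideal_class (s ` I \<otimes>\<^bsub>IG\<^esub> s ` J)"
    using gal_image_ideal_class[OF s c] gal_image_mult[OF s] IJ by simp
  also have "\<dots> = ideal_class (s ` I) \<otimes>\<^bsub>class_group K\<^esub> ideal_class (s ` J)"
    using hom_mult[OF ideal_class_hom] gal_image_carrier[OF s] IJ by simp
  finally show "(`) s ` (C \<otimes>\<^bsub>class_group K\<^esub> D) = (`) s ` C \<otimes>\<^bsub>class_group K\<^esub> (`) s ` D"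
    using gal_image_ideal_class[OF s] IJ by simp
qed

lemma fixed_class_pow_eq_one:
  assumes C: "C \<in> carrier (class_group K)" and fixed: "\<And>s. s \<in> \<Gamma> \<Longrightarrow> (`) s ` C = C"
  shows "C [^]\<^bsub>class_group K\<^esub> card \<Gamma> = \<one>\<^bsub>class_group K\<^esub>"
proof -
  interpret C: comm_group "class_group K" by (rule comm_group_class_group)
  interpret I: comm_group IG by (rule comm_group_IG)
  obtain I where I: "I \<in> carrier IG" "C = ideal_class I" using C by (auto simp: carrier_class_group)
  obtain e where e: "e \<in> K" "e \<noteq> 0" and J: "principal e \<otimes>\<^bsub>IG\<^esub> I \<in> carrier IG" "principal e \<otimes>\<^bsub>IG\<^esub> I \<subseteq> \<O>"
    by (rule integral_representative[OF I(1)])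
  define J where "J = principal e \<otimes>\<^bsub>IG\<^esub> I"
  note J = J[folded J_def]
  \<comment> \<open>\<open>J\<close> differs from \<open>I\<close> by a principal factor.\<close>
  have CJ: "ideal_class J = C"
    unfolding J_def hom_mult[OF ideal_class_hom principal_carrier[OF e] I(1)]
    using ideal_class_principal[OF e] C I(2) by simp
  obtain d where d: "d \<in> K" "d \<noteq> 0" "finprod IG (\<lambda>s. s ` J) \<Gamma> = principal d"
    by (rule ideal_norm_principal[OF J])
  have "\<one>\<^bsub>class_group K\<^esub> = ideal_class (finprod IG (\<lambda>s. s ` J) \<Gamma>)"
    unfolding d(3) using ideal_class_principal[OF d(1,2)] by simp
  also have "\<dots> = finprod (class_group K) (\<lambda>s. ideal_class (s ` J)) \<Gamma>"
    using gal_image_carrier[OF _ J(1)]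
    by (intro I.finprod_group_hom comm_group_class_group ideal_class_hom) auto
  also have "\<dots> = finprod (class_group K) (\<lambda>_. C) \<Gamma>"
  proof (rule C.finprod_cong')
    fix s assume "s \<in> \<Gamma>"
    then show "ideal_class (s ` J) = C"
      using gal_image_ideal_class[OF _ J(1)] CJ fixed by simp
  qed (use C in auto)
  also have "\<dots> = C [^]\<^bsub>class_group K\<^esub> card \<Gamma>" using C by (rule C.finprod_const)
  finally show ?thesis by simp
qed

end

section \<open>Sylow subgroups of the class group\<close>

theorem card_sylow_subgroup_class_group:
  fixes K :: "'a::field_char_0 set"
  assumes "prime p" "galois_number_field K" "degree_over_Q K = p ^ r"
    and "prime q" "p \<noteq> q" "sylow_subgroup q S (class_group K)"
  shows "[card S = 1] (mod p)"
proof (cases "finite (carrier (class_group K))")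
  case False
  \<comment> \<open>An infinite class group has order 0, and \<open>multiplicity q 0\<close> is 0,
    so here \<open>S\<close> has \<open>q ^ 0 = 1\<close> elements.\<close>
  then have "Coset.order (class_group K) = 0" by (simp add: Coset.order_def)
  then show ?thesis using assms(6) by (simp add: sylow_subgroup_def)
next
  case True
  interpret galois_field K using assms(2) by unfold_locales
  interpret C: comm_group "class_group K" by (rule comm_group_class_group)
  have card: "card \<Gamma> = p ^ r" using card_galois_group assms(3) by simp
  \<comment> \<open>Identity and composition in \<open>Gal\<close> are taken relative to
    \<open>K\<close>, so the action laws are checked on ideals contained in
    \<open>K\<close>.\<close>
  have subK: "Y \<subseteq> K" if C: "C \<in> carrier (class_group K)" and Y: "Y \<in> C" for C Y
  proof -
    obtain I where I: "I \<in> carrier IG" "C = ideal_class I" using C by (auto simp: carrier_class_group)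
    then have "Y \<in> carrier IG"
      using Y principal_carrier IG_mult_closed by (auto simp: r_coset_def principal_ideals_def mult_IG)
    then show ?thesis using IG_K by auto
  qed
  show ?thesis
  proof (rule C.card_sylow_subgroup_cong_1[OF True assms(1,4,5) group_Gal, where \<psi> = "\<lambda>s. (`) ((`) s)"])
    show "Coset.order Gal = p ^ r" by (simp add: Coset.order_def carrier_Gal card)
    show "(`) ((`) s) \<in> hom (class_group K) (class_group K)" if "s \<in> carrier Gal" for s
      using that gal_image_hom_class_group by (simp add: carrier_Gal)
    show "(`) \<one>\<^bsub>Gal\<^esub> ` C = C" if C: "C \<in> carrier (class_group K)" for C
    proof -
      have "(\<lambda>x\<in>K. x) ` Y = Y" if "Y \<in> C" for Y
      proof -
        have "(\<lambda>x\<in>K. x) ` Y = (\<lambda>x. x) ` Y"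
          by (rule image_cong) (use subK[OF C that] in auto)
        then show ?thesis by simp
      qed
      then have "(`) (\<lambda>x\<in>K. x) ` C = (\<lambda>Y. Y) ` C" by (intro image_cong) auto
      then show ?thesis by (simp add: one_Gal)
    qed
    show "(`) (s \<otimes>\<^bsub>Gal\<^esub> t) ` C = (`) s ` (`) t ` C"
      if "s \<in> carrier Gal" "t \<in> carrier Gal" and C: "C \<in> carrier (class_group K)" for s t C
    proof -
      have "compose K s t ` Y = s ` t ` Y" if "Y \<in> C" for Y
        using subK[OF C that] by (auto simp: compose_def image_image intro!: image_cong)
      then show ?thesis using that by (simp add: mult_Gal carrier_Gal image_image)
    qed
    show "C [^]\<^bsub>class_group K\<^esub> (p ^ r) = \<one>\<^bsub>class_group K\<^esub>"
      if "C \<in> carrier (class_group K)" "\<And>s. s \<in> carrier Gal \<Longrightarrow> (`) s ` C = C" for C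
      using fixed_class_pow_eq_one[OF that(1)] that(2) card by (simp add: carrier_Gal)
  qed (rule assms(6))
qed

theorem corollary4p8:
  fixes K :: "'a::field_char_0 set" and p r :: nat
  assumes "prime p"
    and "galois_number_field K"
    and "degree_over_Q K = p ^ r"
  shows "(\<forall>q S. prime q \<longrightarrow> sylow_subgroup q S (class_group K) \<longrightarrow>
             S \<noteq> {\<one>\<^bsub>class_group K\<^esub>} \<longrightarrow> p = q \<or> [card S = 1] (mod p))
       \<and> (\<forall>(s::nat) (k::nat) (q::nat \<Rightarrow> nat) (n::nat \<Rightarrow> nat).
             (\<forall>i\<in>{1..k}. prime (q i) \<and> q i \<noteq> p \<and> n i \<ge> 1) \<longrightarrow>
             inj_on q {1..k} \<longrightarrow>
             class_number K = p ^ s * (\<Prod>i\<in>{1..k}. q i ^ n i) \<longrightarrow>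
             (\<forall>i\<in>{1..k}. [q i ^ n i = 1] (mod p)))"
proof (intro conjI allI impI ballI)
  fix q S assume "prime q" "sylow_subgroup q S (class_group K)"
  then show "p = q \<or> [card S = 1] (mod p)"
    using card_sylow_subgroup_class_group[OF assms] by blast
next
  fix s k i :: nat and q n :: "nat \<Rightarrow> nat"
  assume q: "\<forall>i\<in>{1..k}. prime (q i) \<and> q i \<noteq> p \<and> n i \<ge> 1" and inj: "inj_on q {1..k}"
    and h: "class_number K = p ^ s * (\<Prod>i\<in>{1..k}. q i ^ n i)" and i: "i \<in> {1..k}"
  interpret galois_field K using assms(2) by unfold_locales
  \<comment> \<open>The part of the class number that is prime to \<open>q i\<close>.\<close>
  define m where "m = p ^ s * (\<Prod>j\<in>{1..k} - {i}. q j ^ n j)"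
  have order: "Coset.order (class_group K) = q i ^ n i * m"
    using h i by (simp add: class_number_def m_def prod.remove[of _ i] mult_ac)
  have qi: "prime (q i)" using q i by blast
  have "\<not> q i dvd p ^ s"
    using q i prime_dvd_power[OF qi, of p s] primes_dvd_imp_eq[OF qi assms(1)] by blast
  moreover have "\<not> q i dvd (\<Prod>j\<in>{1..k} - {i}. q j ^ n j)"
  proof
    assume "q i dvd (\<Prod>j\<in>{1..k} - {i}. q j ^ n j)"
    then have "\<exists>j\<in>{1..k} - {i}. q i dvd q j ^ n j"
      by (subst (asm) prime_dvd_prod_iff) (use qi in simp_all)
    then obtain j where j: "j \<in> {1..k} - {i}" "q i dvd q j ^ n j" by (elim bexE)
    have "prime (q j)" using q j(1) by blast
    moreover have "q i dvd q j" using prime_dvd_power[OF qi j(2)] .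
    ultimately have eq: "q i = q j" using primes_dvd_imp_eq[OF qi] by blast
    have "i = j" by (rule inj_onD[OF inj eq i]) (use j(1) in blast)
    then show False using j(1) by blast
  qed
  ultimately have nm: "\<not> q i dvd m" using qi by (simp add: m_def prime_dvd_mult_iff)
  then have m0: "m \<noteq> 0" by (metis dvd_0_right)
  have mult: "multiplicity (q i) (Coset.order (class_group K)) = n i"
    unfolding order using qi nm m0
    by (subst prime_elem_multiplicity_mult_distrib) (auto simp: not_dvd_imp_multiplicity_0)
  \<comment> \<open>The given factorisation is non-zero, whereas an infinite group would have order
    0; so the class group is finite, as Sylow's theorem requires.\<close>
  have "Coset.order (class_group K) > 0"
    unfolding order using m0 prime_gt_0_nat[OF qi] by simp
  then have fin: "finite (carrier (class_group K))"
    unfolding Coset.order_def by (rule card_ge_0_finite)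
  obtain S where S: "subgroup S (class_group K)" "card S = q i ^ n i"
    using sylow_thm[OF qi comm_group.axioms(2)[OF comm_group_class_group] order fin] by blast
  have "[card S = 1] (mod p)"
    by (rule card_sylow_subgroup_class_group[OF assms qi]) (use S mult q i in \<open>auto simp: sylow_subgroup_def\<close>)
  then show "[q i ^ n i = 1] (mod p)" using S(2) by simp
qed

end
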